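(* Let $S$ be a finite non-empty set and $\Sigma\subseteq\mathbb{R}_+\times S$ locally finite, and let $(X_n,\eta_n)$ be a time-homogeneous irreducible Markov chain on $\Sigma$ such that every line $\Lambda_k=\{x\in\mathbb{R}_+:(x,k)\in\Sigma\}$, $k\in S$, is unbounded. Suppose that for some $p>2$ there is $C_p<\infty$ with $\mathbb{E}_{x,i}[|X_{n+1}-X_n|^p]\le C_p$ for all $(x,i)\in\Sigma$. Suppose that $q_{ij}(x)\to q_{ij}$ as $x\to\infty$ for all $i,j\in S$, where $(q_{ij})$ is an irreducible stochastic matrix with stationary distribution $\pi$. Suppose there exist $c_i\in\mathbb{R}$ and $s_i^2\ge0$, $i\in S$, with at least one $s_i^2\neq0$, such that $\mu_i(x)=\frac{c_i}{x}+o(x^{-1})$ and $\sigma_i^2(x)=s_i^2+o(1)$ as $x\to\infty$. If for some $\theta\in(0,\frac p2]$ \[\sum_{i\in S}\left[2c_i+(2\theta-1)s_i^2\right]\pi_i>0,\] then for any $s\ge\theta$ we have $\mathbb{E}[\tau_x^s]=\infty$ for all sufficiently large $X_0>x$.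
   Context: Locally finite means $\Sigma\cap([0,r]\times S)$ is finite for every $r\ge0$. Write $\mathbb{E}_{x,i}[\cdot]=\mathbb{E}[\cdot\mid X_n=x,\eta_n=i]$ and $\Pr_{x,i}$ similarly. Define $q_{ij}(x)=\Pr_{x,i}[\eta_{n+1}=j]$, $\mu_i(x)=\mathbb{E}_{x,i}[X_{n+1}-X_n]$, $\sigma_i^2(x)=\mathbb{E}_{x,i}[(X_{n+1}-X_n)^2]$. The stationary distribution $\pi=(\pi_i)_{i\in S}$ is the unique probability vector with $\pi_j=\sum_i\pi_iq_{ij}$. For $x\in\mathbb{R}_+$, $\tau_x=\min\{n\ge0: X_n\le x\}$. *)

theory Defs
  imports "HOL-Probability.Probability"
begin

text \<open>States are pairs (x, i) with x a nonnegative real and i in a finite type 's.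
  The transition law of the time-homogeneous chain is a kernel K :: state => state pmf
  (the state space Sigma is locally finite, hence countable, so transitions are discrete).\<close>

definition line :: "(real \<times> 's) set \<Rightarrow> 's \<Rightarrow> real set" where
  "line Sig k = {x. (x, k) \<in> Sig}"

definition locally_finite_set :: "(real \<times> 's) set \<Rightarrow> bool" where
  "locally_finite_set Sig \<longleftrightarrow> (\<forall>r\<ge>0. finite (Sig \<inter> ({0..r} \<times> UNIV)))"

text \<open>Irreducibility of the chain on Sig: every state of Sig leads to every state of Sig.\<close>
definition irreducible_kernel :: "('z \<Rightarrow> 'z pmf) \<Rightarrow> 'z set \<Rightarrow> bool" where
  "irreducible_kernel K Sig \<longleftrightarrow>
     (\<forall>z\<in>Sig. \<forall>w\<in>Sig. (z, w) \<in> {(u, v). v \<in> set_pmf (K u)}\<^sup>*)"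

definition stochastic_matrix :: "('s::finite \<Rightarrow> 's \<Rightarrow> real) \<Rightarrow> bool" where
  "stochastic_matrix Q \<longleftrightarrow> (\<forall>i j. Q i j \<ge> 0) \<and> (\<forall>i. (\<Sum>j\<in>UNIV. Q i j) = 1)"

definition irreducible_matrix :: "('s \<Rightarrow> 's \<Rightarrow> real) \<Rightarrow> bool" where
  "irreducible_matrix Q \<longleftrightarrow> (\<forall>i j. (i, j) \<in> {(a, b). Q a b > 0}\<^sup>*)"

text \<open>The stationary distribution: the unique probability vector with pi_j = sum_i pi_i Q_ij.\<close>
definition stationary_distribution :: "('s::finite \<Rightarrow> 's \<Rightarrow> real) \<Rightarrow> ('s \<Rightarrow> real) \<Rightarrow> bool" where
  "stationary_distribution Q \<pi> \<longleftrightarrow>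
     (\<forall>i. \<pi> i \<ge> 0) \<and> (\<Sum>i\<in>UNIV. \<pi> i) = 1 \<and> (\<forall>j. \<pi> j = (\<Sum>i\<in>UNIV. \<pi> i * Q i j)) \<and>
     (\<forall>\<rho>. (\<forall>i. \<rho> i \<ge> 0) \<and> (\<Sum>i\<in>UNIV. \<rho> i) = 1 \<and> (\<forall>j. \<rho> j = (\<Sum>i\<in>UNIV. \<rho> i * Q i j))
           \<longrightarrow> \<rho> = \<pi>)"

text \<open>One-step quantities q_ij(x), mu_i(x), sigma_i^2(x) computed from the kernel.\<close>
definition q_fun :: "(real \<times> 's \<Rightarrow> (real \<times> 's) pmf) \<Rightarrow> 's \<Rightarrow> 's \<Rightarrow> real \<Rightarrow> real" where
  "q_fun K i j x = measure_pmf.prob (K (x, i)) {w. snd w = j}"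

definition mu_fun :: "(real \<times> 's \<Rightarrow> (real \<times> 's) pmf) \<Rightarrow> 's \<Rightarrow> real \<Rightarrow> real" where
  "mu_fun K i x = measure_pmf.expectation (K (x, i)) (\<lambda>w. fst w - x)"

definition sigma2_fun :: "(real \<times> 's \<Rightarrow> (real \<times> 's) pmf) \<Rightarrow> 's \<Rightarrow> real \<Rightarrow> real" where
  "sigma2_fun K i x = measure_pmf.expectation (K (x, i)) (\<lambda>w. (fst w - x)\<^sup>2)"

text \<open>A realization of the Markov chain with kernel K started at z0: a process Z on a
  probability space M with Z_0 = z0 almost surely and the (discrete) Markov property.\<close>
definition markov_chain_from ::
  "'w measure \<Rightarrow> (nat \<Rightarrow> 'w \<Rightarrow> 'z) \<Rightarrow> ('z \<Rightarrow> 'z pmf) \<Rightarrow> 'z \<Rightarrow> bool" where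
  "markov_chain_from M Z K z0 \<longleftrightarrow>
     prob_space M \<and>
     (\<forall>n. Z n \<in> measurable M (count_space UNIV)) \<and>
     (AE \<omega> in M. Z 0 \<omega> = z0) \<and>
     (\<forall>n h w. measure M {\<omega>\<in>space M. (\<forall>k\<le>n. Z k \<omega> = h k) \<and> Z (Suc n) \<omega> = w}
              = measure M {\<omega>\<in>space M. \<forall>k\<le>n. Z k \<omega> = h k} * pmf (K (h n)) w)"

text \<open>tau_x = min {n >= 0. X_n <= x}, infinite if no such n.\<close>
definition hitting_time :: "(nat \<Rightarrow> 'w \<Rightarrow> real \<times> 's) \<Rightarrow> real \<Rightarrow> 'w \<Rightarrow> enat" where
  "hitting_time Z x \<omega> =
     (if \<exists>n. fst (Z n \<omega>) \<le> x then enat (LEAST n. fst (Z n \<omega>) \<le> x) else \<infinity>)"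

text \<open>The s-th moment E[tau^s] as an extended nonnegative real.\<close>
definition moment_enat :: "'w measure \<Rightarrow> ('w \<Rightarrow> enat) \<Rightarrow> real \<Rightarrow> ennreal" where
  "moment_enat M T s =
     (\<integral>\<^sup>+ \<omega>. (case T \<omega> of enat n \<Rightarrow> ennreal (real n powr s) | \<infinity> \<Rightarrow> \<infinity>) \<partial>M)"

end

theory Submission
  imports Defs "HOL-Real_Asymp.Real_Asymp"
begin

text \<open>
  Write \<open>y = x + 1\<close> and suppose \<open>E \<tau>\<^sup>s < \<infinity>\<close>. Since the drift hypothesis is strict, it persists for some
  \<open>\<theta>' < \<theta>\<close>, and with \<open>q = 2 \<theta>'\<close> the function \<open>f(x, i) = y\<^sup>q + (q / 2) b\<^sub>i y\<^sup>q\<^sup>-\<^sup>2\<close> is a submartingale far out;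
  the corrector \<open>b\<close>, which averages the drift over the lines, comes from a separating hyperplane:
  a separating functional would be a multiple of \<open>\<pi>\<close>.
  Hence \<open>f(X\<^sub>0)\<close> is at most a constant plus \<open>E[f(X\<^sub>n); \<tau> > n]\<close>, and it remains to see that the latter
  tends to \<open>0\<close>. This follows from \<open>y\<^sup>q \<le> n\<^bsup>\<theta>' - \<theta>\<^esup> w\<^sub>n\<close> for a function \<open>w\<^sub>n\<close> comparable to
  \<open>(y\<^sup>2 + n)\<^bsup>\<theta>\<^esup>\<close>: its killed expectation \<open>a\<^sub>n = E[w\<^sub>n; \<tau> > n]\<close> satisfies
  \<open>a\<^sub>n\<^sub>+\<^sub>1 \<le> (1 + \<kappa> / n) a\<^sub>n + C n\<^bsup>\<theta> - 1\<^esup> P(\<tau> > n)\<close> with \<open>\<kappa>\<close> as small as desired, while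
  \<open>P(\<tau> > n) = O(n\<^bsup>- \<theta>\<^esup>)\<close>, so \<open>a\<^sub>n\<close> grows slower than any prescribed power of \<open>n\<close>.
\<close>

section \<open>Elementary inequalities and the corrector\<close>

text \<open>Near zero the remainder is o(t^2), which allows an arbitrarily small \<open>e\<close>.
  Away from zero every term is a power of order at most \<open>p\<close>, hence at most a constant
  times |t|^p. With t a relative jump, the moment assumption controls that second part.\<close>

lemma powr_taylor2:
  fixes p q e :: real
  assumes "0 < q" "q \<le> p" "2 < p" "0 < e"
  obtains C where "0 \<le> C" "\<And>t. -1 \<le> t \<Longrightarrow>
    \<bar>(1 + t) powr q - 1 - q * t - q * (q - 1) / 2 * t\<^sup>2\<bar> \<le> e * t\<^sup>2 + C * \<bar>t\<bar> powr p"
proof -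
  define \<phi> where "\<phi> t = (1 + t) powr q - 1 - q * t - q * (q - 1) / 2 * t\<^sup>2" for t :: real
  have "((\<lambda>t. \<phi> t / t\<^sup>2) \<longlongrightarrow> 0) (at 0)"
    unfolding \<phi>_def by real_asymp
  then have "\<forall>\<^sub>F t in at 0. dist (\<phi> t / t\<^sup>2) 0 < e"
    using \<open>0 < e\<close> by (rule tendstoD)
  then obtain d where d: "d > 0" "\<And>t. t \<noteq> 0 \<Longrightarrow> \<bar>t\<bar> < d \<Longrightarrow> \<bar>\<phi> t / t\<^sup>2\<bar> < e"
    unfolding eventually_at by (auto simp: dist_real_def)
  \<comment> \<open>The four summands bound (1 + t)^q, 1, q t and the quadratic term, in this order,
    by multiples of |t|^p once |t| \<ge> d.\<close>
  define C where "C = (1 + 1/d) powr q * d powr (q - p) + d powr (0 - p) + q * d powr (1 - p)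
      + \<bar>q * (q - 1) / 2\<bar> * d powr (2 - p)"
  have small: "\<bar>\<phi> t\<bar> \<le> e * t\<^sup>2" if "\<bar>t\<bar> < d" for t
  proof (cases "t = 0")
    case False
    with d(2)[OF this that] show ?thesis
      by (simp add: abs_divide field_simps)
  qed (simp add: \<phi>_def)
  have large: "\<bar>\<phi> t\<bar> \<le> C * \<bar>t\<bar> powr p" if "d \<le> \<bar>t\<bar>" "-1 \<le> t" for t
  proof -
    have pw: "\<bar>t\<bar> powr r \<le> d powr (r - p) * \<bar>t\<bar> powr p" if "r \<le> p" for r
    proof -
      have "\<bar>t\<bar> powr (r - p) \<le> d powr (r - p)"
        using that \<open>d \<le> \<bar>t\<bar>\<close> d(1) by (intro powr_mono2') auto
      then have "\<bar>t\<bar> powr (r - p) * \<bar>t\<bar> powr p \<le> d powr (r - p) * \<bar>t\<bar> powr p"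
        by (intro mult_right_mono) auto
      then show ?thesis by (simp add: powr_add[symmetric])
    qed
    have "t \<noteq> 0" using that d(1) by auto
    have "(1 + t) powr q \<le> ((1 + 1/d) * \<bar>t\<bar>) powr q"
    proof (intro powr_mono2)
      have "1 \<le> \<bar>t\<bar> / d" using that d(1) by (simp add: field_simps)
      then show "1 + t \<le> (1 + 1/d) * \<bar>t\<bar>" by (simp add: algebra_simps)
    qed (use that assms in auto)
    also have "\<dots> = (1 + 1/d) powr q * \<bar>t\<bar> powr q"
      using d(1) by (simp add: powr_mult)
    also have "\<dots> \<le> (1 + 1/d) powr q * (d powr (q - p) * \<bar>t\<bar> powr p)"
      using pw[of q] assms by (intro mult_left_mono) auto
    finally have 1: "(1 + t) powr q \<le> (1 + 1/d) powr q * (d powr (q - p) * \<bar>t\<bar> powr p)" .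
    have 2: "1 \<le> d powr (0 - p) * \<bar>t\<bar> powr p" using pw[of 0] assms \<open>t \<noteq> 0\<close> by simp
    have "\<bar>t\<bar> \<le> d powr (1 - p) * \<bar>t\<bar> powr p" using pw[of 1] assms by simp
    then have 3: "\<bar>q * t\<bar> \<le> q * (d powr (1 - p) * \<bar>t\<bar> powr p)"
      using assms by (simp add: abs_mult)
    have "t\<^sup>2 \<le> d powr (2 - p) * \<bar>t\<bar> powr p"
      using pw[of 2] assms \<open>t \<noteq> 0\<close> by (simp add: powr_numeral)
    then have 4: "\<bar>q * (q - 1) / 2 * t\<^sup>2\<bar> \<le> \<bar>q * (q - 1) / 2\<bar> * (d powr (2 - p) * \<bar>t\<bar> powr p)"
      unfolding abs_mult by (intro mult_left_mono) (auto simp: abs_mult)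
    have "(1 + t) powr q \<ge> 0" by simp
    then have "\<bar>\<phi> t\<bar> \<le> (1 + t) powr q + 1 + \<bar>q * t\<bar> + \<bar>q * (q - 1) / 2 * t\<^sup>2\<bar>"
      unfolding \<phi>_def by linarith
    also have "\<dots> \<le> C * \<bar>t\<bar> powr p"
      using 1 2 3 4 by (simp add: C_def algebra_simps)
    finally show ?thesis .
  qed
  have "0 \<le> C" unfolding C_def using assms by (intro add_nonneg_nonneg mult_nonneg_nonneg) auto
  moreover have "\<bar>\<phi> t\<bar> \<le> e * t\<^sup>2 + C * \<bar>t\<bar> powr p" if "-1 \<le> t" for t
  proof (cases "\<bar>t\<bar> < d")
    case True
    then show ?thesis using small[of t] \<open>0 \<le> C\<close> by (simp add: add_increasing2)
  next
    case False
    then show ?thesis using large[of t] that \<open>0 < e\<close> by (simp add: add_increasing)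
  qed
  ultimately show thesis using that unfolding \<phi>_def by blast
qed

text \<open>For m outside [0, 1] this comes from the tangent at 0 of a convex function. For m in
  [0, 1] and negative t the bound by 1 + t takes over, and that is what the extra 1 in |m| + 1 pays
  for. The corrector needs m = q - 2, which may be negative.\<close>

lemma powr_Bernoulli:
  fixes t m :: real
  assumes "-1 < t"
  shows "1 - (\<bar>m\<bar> + 1) * \<bar>t\<bar> \<le> (1 + t) powr m"
proof (cases "0 \<le> m \<and> m \<le> 1")
  case True
  show ?thesis
  proof (cases "0 \<le> t")
    case True
    then have "1 \<le> (1 + t) powr m" using \<open>0 \<le> m \<and> m \<le> 1\<close> by (simp add: ge_one_powr_ge_zero)
    then show ?thesis using True by (smt (verit) mult_nonneg_nonneg abs_ge_zero)
  next
    case False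
    have "(1 + t) powr 1 \<le> (1 + t) powr m"
      using \<open>0 \<le> m \<and> m \<le> 1\<close> False assms by (intro powr_mono') auto
    moreover have "1 - (\<bar>m\<bar> + 1) * \<bar>t\<bar> \<le> 1 + t"
      using False \<open>0 \<le> m \<and> m \<le> 1\<close> by (simp add: algebra_simps mult_nonneg_nonpos)
    ultimately show ?thesis using assms by simp
  qed
next
  case False
  have "1 + m * t \<le> (1 + t) powr m"
  proof -
    \<comment> \<open>\<open>g\<close> is the derivative of \<open>F\<close> and is nonnegative to
      the right of 0 and nonpositive to the left, so \<open>F\<close> is smallest at 0.\<close>
    define g where "g = (\<lambda>u::real. m * (1 + u) powr (m - 1) - m)"
    define F where "F = (\<lambda>u::real. (1 + u) powr m - 1 - m * u)"
    have DF: "(F has_real_derivative g u) (at u)" if "-1 < u" for u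
      unfolding F_def g_def using that by (auto intro!: derivative_eq_intros)
    have gpos: "0 \<le> g u" if "0 \<le> u" for u
    proof (cases "m > 1")
      case True
      then have "1 \<le> (1 + u) powr (m - 1)" using that by (simp add: ge_one_powr_ge_zero)
      then show ?thesis using True by (simp add: g_def)
    next
      case f: False
      then have "m < 0" using False by auto
      moreover have "(1 + u) powr (m - 1) \<le> 1" using that \<open>m < 0\<close> powr_mono2'[of "m - 1" 1 "1 + u"] by simp
      ultimately show ?thesis unfolding g_def by (simp add: mult_le_cancel_left)
    qed
    have gneg: "g u \<le> 0" if "u \<le> 0" "-1 < u" for u
    proof (cases "m > 1")
      case True
      then have "(1 + u) powr (m - 1) \<le> 1" using that by (simp add: powr_le1)
      then show ?thesis using True by (simp add: g_def)
    next
      case f: False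
      then have "m < 0" using False by auto
      moreover have "1 \<le> (1 + u) powr (m - 1)"
        using that \<open>m < 0\<close> powr_mono2'[of "m - 1" "1 + u" 1] by simp
      ultimately show ?thesis unfolding g_def by (simp add: mult_le_cancel_left)
    qed
    have "F 0 \<le> F t"
    proof (cases "0 \<le> t")
      case True
      show ?thesis
        by (rule DERIV_nonneg_imp_nondecreasing[OF True]) (use DF gpos in force)
    next
      case False
      show ?thesis
        by (rule DERIV_nonpos_imp_nonincreasing) (use False DF gneg assms in force)+
    qed
    then show ?thesis by (simp add: F_def)
  qed
  moreover have "- (\<bar>m\<bar> * \<bar>t\<bar>) \<le> m * t" by (metis abs_ge_minus_self abs_mult minus_le_iff)
  ultimately show ?thesis by (simp add: algebra_simps)
qed

text \<open>The quantity \<open>a\<close> is positive only on average over \<pi>; adding Q b - b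
  makes it positive on each line separately. If the affine range of \<open>T\<close> missed the open
  positive orthant, a separating functional \<open>l\<close> would be nonnegative and invariant
  under \<open>Q\<close>, hence proportional to \<pi> by uniqueness, and it would force the average
  to be nonpositive.\<close>

lemma corrector_exists:
  fixes Q :: "'s::finite \<Rightarrow> 's \<Rightarrow> real" and a \<pi> :: "'s \<Rightarrow> real"
  assumes Q: "stochastic_matrix Q" and st: "stationary_distribution Q \<pi>"
    and pos: "(\<Sum>i\<in>UNIV. a i * \<pi> i) > 0"
  obtains b e where "0 < e" "\<And>i. 0 \<le> b i" "\<And>i. e \<le> a i + (\<Sum>j\<in>UNIV. Q i j * b j) - b i"
proof -
  define T :: "(real, 's) vec \<Rightarrow> (real, 's) vec"
    where "T b = (\<chi> i. a i + (\<Sum>j\<in>UNIV. Q i j * b $ j) - b $ i)" for b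
  define P :: "(real, 's) vec set" where "P = {v. \<forall>i. 0 < v $ i}"
  have "\<exists>b. T b \<in> P"
  proof (rule ccontr)
    assume "\<not> ?thesis"
    then have disj: "range T \<inter> P = {}" by auto
    have "P = (\<Inter>i. {v. 0 < v $ i})" by (auto simp: P_def)
    then have "convex P"
      using convex_halfspace_gt[of 0 "axis _ (1::real)"]
      by (auto simp: inner_axis' intro!: convex_INT)
    moreover have "convex (range T)"
      unfolding convex_alt
    proof safe
      fix x y and u :: real
      have "(1 - u) *\<^sub>R T x + u *\<^sub>R T y = T ((1 - u) *\<^sub>R x + u *\<^sub>R y)"
        by (simp add: T_def vec_eq_iff algebra_simps sum.distrib sum_distrib_left sum_subtractf)
      then show "(1 - u) *\<^sub>R T x + u *\<^sub>R T y \<in> range T" by simp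
    qed
    moreover have "(\<chi> i. 1) \<in> P" by (simp add: P_def)
    ultimately obtain l c where l: "l \<noteq> 0" "\<forall>x\<in>range T. l \<bullet> x \<le> c" "\<forall>x\<in>P. c \<le> l \<bullet> x"
      using separating_hyperplane_sets[of "range T" P] disj by blast
    have lv: "c \<le> (\<Sum>i\<in>UNIV. l $ i * v i)" if "\<And>i. 0 < v i" for v
      using l(3)[rule_format, of "\<chi> i. v i"] that by (simp add: P_def inner_vec_def)
    have lT: "(\<Sum>i\<in>UNIV. l $ i * (a i + (\<Sum>j\<in>UNIV. Q i j * v j) - v i)) \<le> c" for v
      using l(2)[rule_format, OF rangeI[of T "\<chi> i. v i"]] by (simp add: T_def inner_vec_def)
    \<comment> \<open>The constant vectors with entries \<open>e / S\<close> lie in the orthant and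
      approach 0.\<close>
    have c0: "c \<le> 0"
    proof (rule field_le_epsilon)
      fix e :: real assume "e > 0"
      define S where "S = (\<Sum>i\<in>UNIV. \<bar>l $ i\<bar>) + 1"
      have "S > 0" unfolding S_def by (smt (verit) sum_nonneg abs_ge_zero)
      then have "c \<le> (\<Sum>i\<in>UNIV. l $ i * (e / S))" using lv[of "\<lambda>_. e / S"] \<open>e > 0\<close> by simp
      also have "\<dots> = (\<Sum>i\<in>UNIV. l $ i) * (e / S)" by (rule sum_distrib_right[symmetric])
      also have "\<dots> \<le> S * (e / S)"
        using \<open>S > 0\<close> \<open>e > 0\<close> unfolding S_def
        by (intro mult_right_mono) (auto intro!: add_increasing2 sum_mono)
      finally show "c \<le> 0 + e" using \<open>S > 0\<close> by simp
    qed
    \<comment> \<open>A negative coordinate would make \<open>l\<close> unbounded below on the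
      orthant: take a large \<open>t\<close> in that coordinate and 1 elsewhere.\<close>
    have lnn: "0 \<le> l $ k" for k
    proof (rule ccontr)
      assume "\<not> 0 \<le> l $ k"
      define S where "S = (\<Sum>i\<in>UNIV - {k}. l $ i)"
      define t where "t = max 1 ((\<bar>S\<bar> + \<bar>c\<bar> + 1) / (- l $ k))"
      have "c \<le> (\<Sum>i\<in>UNIV. l $ i * (if i = k then t else 1))"
        by (rule lv) (auto simp: t_def)
      also have "\<dots> = l $ k * t + S"
        unfolding S_def by (subst sum.remove[of _ k]) auto
      finally have 1: "c \<le> l $ k * t + S" .
      have "(\<bar>S\<bar> + \<bar>c\<bar> + 1) / (- l $ k) \<le> t" by (simp add: t_def)
      then have "\<bar>S\<bar> + \<bar>c\<bar> + 1 \<le> - l $ k * t"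
        using \<open>\<not> 0 \<le> l $ k\<close> by (simp add: field_simps)
      then show False using 1 by linarith
    qed
    define L where "L = (\<Sum>i\<in>UNIV. l $ i)"
    have "L > 0"
    proof -
      obtain k where "l $ k \<noteq> 0" using l(1) by (auto simp: vec_eq_iff)
      then have "0 < l $ k" using lnn[of k] by simp
      then show ?thesis unfolding L_def by (rule sum_pos2[rotated 2]) (auto simp: lnn)
    qed
    define d where "d j = (\<Sum>i\<in>UNIV. l $ i * Q i j) - l $ j" for j
    define A where "A = (\<Sum>i\<in>UNIV. l $ i * a i)"
    have lT': "A + (\<Sum>j\<in>UNIV. d j * v j) \<le> c" for v
    proof -
      have "(\<Sum>i\<in>UNIV. l $ i * (a i + (\<Sum>j\<in>UNIV. Q i j * v j) - v i))
          = A + (\<Sum>i\<in>UNIV. \<Sum>j\<in>UNIV. l $ i * Q i j * v j) - (\<Sum>j\<in>UNIV. l $ j * v j)"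
        by (simp add: A_def algebra_simps sum.distrib sum_subtractf sum_distrib_left)
      also have "(\<Sum>i\<in>UNIV. \<Sum>j\<in>UNIV. l $ i * Q i j * v j) = (\<Sum>j\<in>UNIV. \<Sum>i\<in>UNIV. l $ i * Q i j * v j)"
        by (rule sum.swap)
      also have "A + \<dots> - (\<Sum>j\<in>UNIV. l $ j * v j) = A + (\<Sum>j\<in>UNIV. d j * v j)"
        by (simp add: d_def algebra_simps sum_distrib_left sum_subtractf)
      finally show ?thesis using lT[of v] by simp
    qed
    \<comment> \<open>An affine function bounded above on the whole space is constant; otherwise a
      test vector supported at \<open>j\<close> exceeds the bound.\<close>
    have d0: "d j = 0" for j
    proof (rule ccontr)
      assume "d j \<noteq> 0"
      have "A + (\<Sum>i\<in>UNIV. d i * (if i = j then (\<bar>c\<bar> + \<bar>A\<bar> + 1) / d j else 0)) \<le> c"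
        by (rule lT')
      also have "(\<Sum>i\<in>UNIV. d i * (if i = j then (\<bar>c\<bar> + \<bar>A\<bar> + 1) / d j else 0)) = \<bar>c\<bar> + \<bar>A\<bar> + 1"
        using \<open>d j \<noteq> 0\<close> by (simp add: if_distrib sum.delta cong: if_cong)
      finally show False by linarith
    qed
    have uniq: "\<rho> = \<pi>" if "\<forall>i. \<rho> i \<ge> 0" "(\<Sum>i\<in>UNIV. \<rho> i) = 1"
        "\<forall>j. \<rho> j = (\<Sum>i\<in>UNIV. \<rho> i * Q i j)" for \<rho>
      using st that unfolding stationary_distribution_def by blast
    have "(\<lambda>i. l $ i / L) = \<pi>"
    proof (rule uniq; (intro allI)?)
      show "(\<Sum>i\<in>UNIV. l $ i / L) = 1"
        using \<open>L > 0\<close> by (simp add: sum_divide_distrib[symmetric] L_def[symmetric])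
      show "l $ j / L = (\<Sum>i\<in>UNIV. l $ i / L * Q i j)" for j
        using d0[of j] by (simp add: d_def sum_divide_distrib[symmetric])
      show "0 \<le> l $ i / L" for i using lnn \<open>L > 0\<close> by simp
    qed
    then have "\<pi> i = l $ i / L" for i by (simp add: fun_eq_iff)
    then have "A / L = (\<Sum>i\<in>UNIV. a i * \<pi> i)"
      by (simp add: A_def sum_divide_distrib mult.commute)
    moreover have "A \<le> 0" using lT'[of "\<lambda>_. 0"] c0 by simp
    ultimately show False using pos \<open>L > 0\<close> by (metis divide_nonpos_pos not_le)
  qed
  then obtain b where b: "\<And>i. 0 < a i + (\<Sum>j\<in>UNIV. Q i j * b $ j) - b $ i"
    by (auto simp: T_def P_def)
  \<comment> \<open>The rows of \<open>Q\<close> sum to 1, so a common shift of \<open>b\<close>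
    leaves Q b - b unchanged; subtracting the minimum makes the corrector nonnegative.\<close>
  define m where "m = Min (range (\<lambda>i. b $ i))"
  define e where "e = Min (range (\<lambda>i. a i + (\<Sum>j\<in>UNIV. Q i j * b $ j) - b $ i))"
  have eq: "(\<Sum>j\<in>UNIV. Q i j * (b $ j - m)) - (b $ i - m) = (\<Sum>j\<in>UNIV. Q i j * b $ j) - b $ i" for i
    using Q unfolding stochastic_matrix_def
    by (simp add: right_diff_distrib sum_subtractf sum_distrib_right[symmetric])
  show thesis
  proof (rule that)
    show "0 < e" unfolding e_def using b by (subst Min_gr_iff) auto
    show "0 \<le> b $ i - m" for i unfolding m_def by simp
    show "e \<le> a i + (\<Sum>j\<in>UNIV. Q i j * (b $ j - m)) - (b $ i - m)" for i
    proof -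
      have "e \<le> a i + (\<Sum>j\<in>UNIV. Q i j * b $ j) - b $ i" unfolding e_def by (rule Min_le) auto
      then show ?thesis using eq[of i] by linarith
    qed
  qed
qed

section \<open>The killed Markov chain\<close>

lemma sets_stays_in:
  assumes "\<And>k. Z k \<in> measurable M (count_space UNIV)"
  shows "{\<omega>\<in>space M. \<forall>k\<le>n::nat. Z k \<omega> \<in> A k} \<in> sets M"
proof -
  have "{\<omega>\<in>space M. Z k \<omega> \<in> A k} \<in> sets M" for k
    using measurable_sets[OF assms[of k], of "A k"] by (simp add: vimage_def Int_def conj_commute)
  then have "{\<omega>\<in>space M. \<forall>k\<in>{..n}. Z k \<omega> \<in> A k} \<in> sets M"
    by (rule sets.sets_Collect_finite_All) (rule finite_atMost)
  then show ?thesis unfolding Ball_def atMost_iff .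
qed

text \<open>The Markov property is given for single points only; here it is lifted to arbitrary
  nonnegative \<open>g\<close>. The type of states may be uncountable, so agreement on singletons
  does not suffice: the law \<open>N\<close> of the next state on the cylinder must also be seen to
  have no mass off the countable support \<open>S\<close>.\<close>

lemma markov_chain_cylinder_step:
  fixes g :: "'z \<Rightarrow> ennreal"
  assumes mc: "markov_chain_from M Z K z"
  defines "E n h \<equiv> {\<omega>\<in>space M. \<forall>k\<le>n. Z k \<omega> = h k}"
  shows "(\<integral>\<^sup>+\<omega>. g (Z (Suc n) \<omega>) * indicator (E n h) \<omega> \<partial>M)
       = emeasure M (E n h) * (\<integral>\<^sup>+v. g v \<partial>K (h n))"
proof -
  interpret prob_space M using mc by (simp add: markov_chain_from_def)
  have Z[measurable]: "Z k \<in> measurable M (count_space UNIV)" for k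
    using mc by (simp add: markov_chain_from_def)
  have E[measurable]: "E n h \<in> sets M" unfolding E_def using sets_stays_in[OF Z, where A = "\<lambda>k. {h k}" and n = n] by simp
  define N where "N = distr (density M (indicator (E n h))) (count_space UNIV) (Z (Suc n))"
  define c where "c = emeasure M (E n h)"
  define S where "S = set_pmf (K (h n))"
  have N: "emeasure N A = emeasure M (E n h \<inter> {\<omega>\<in>space M. Z (Suc n) \<omega> \<in> A})" for A
  proof -
    have "emeasure N A = (\<integral>\<^sup>+\<omega>. indicator (E n h) \<omega> * indicator (Z (Suc n) -` A \<inter> space M) \<omega> \<partial>M)"
      unfolding N_def by (simp add: emeasure_distr emeasure_density)
    also have "\<dots> = (\<integral>\<^sup>+\<omega>. indicator (E n h \<inter> {\<omega>\<in>space M. Z (Suc n) \<omega> \<in> A}) \<omega> \<partial>M)"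
      by (intro nn_integral_cong) (auto simp: indicator_def)
    also have "\<dots> = emeasure M (E n h \<inter> {\<omega>\<in>space M. Z (Suc n) \<omega> \<in> A})"
      using measurable_sets[OF Z[of "Suc n"], of A] E
      by (intro nn_integral_indicator) (simp add: vimage_def Int_def conj_commute)
    finally show ?thesis .
  qed
  have sgl: "emeasure N {w} = c * pmf (K (h n)) w" for w
  proof -
    have "E n h \<inter> {\<omega>\<in>space M. Z (Suc n) \<omega> \<in> {w}}
        = {\<omega>\<in>space M. (\<forall>k\<le>n. Z k \<omega> = h k) \<and> Z (Suc n) \<omega> = w}"
      by (auto simp: E_def)
    then show ?thesis
      using mc by (simp add: N markov_chain_from_def emeasure_eq_measure E_def c_def ennreal_mult)
  qed
  have tot: "emeasure N UNIV = c"
    unfolding N c_def by (intro arg_cong[where f="emeasure M"]) (auto simp: E_def)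
  have "countable S" by (simp add: S_def)
  have [simp]: "sets N = UNIV" "space N = UNIV" by (auto simp: N_def)
  \<comment> \<open>The point masses over \<open>S\<close> already add up to the total mass
    \<open>c\<close>, so nothing is left for the complement.\<close>
  have "emeasure N S = (\<integral>\<^sup>+w. emeasure N {w} \<partial>count_space S)"
    using \<open>countable S\<close> by (intro emeasure_countable_singleton) auto
  also have "\<dots> = c * (\<integral>\<^sup>+w. pmf (K (h n)) w \<partial>count_space S)"
    by (simp add: sgl nn_integral_cmult)
  also have "(\<integral>\<^sup>+w. pmf (K (h n)) w \<partial>count_space S) = emeasure (K (h n)) S"
    by (simp add: nn_integral_pmf)
  also have "\<dots> = 1" unfolding S_def
    by (simp add: emeasure_pmf)
  finally have NS: "emeasure N S = c" by simp
  have cfin: "c < \<infinity>" by (simp add: c_def emeasure_eq_measure)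
  have "emeasure N (UNIV - S) = emeasure N UNIV - emeasure N S"
    using cfin NS by (intro emeasure_Diff) auto
  then have "emeasure N (- S) = 0"
    using cfin by (simp add: tot NS Compl_eq_Diff_UNIV)
  then have AE_N: "AE w in N. w \<in> S"
    by (intro AE_I[of _ _ "- S"]) auto
  define N' where "N' = scale_measure c (measure_pmf (K (h n)))"
  have "N = N'"
  proof (rule measure_eqI_countable_AE)
    show "AE w in N'. w \<in> S"
    proof (rule AE_I[of _ _ "- S"])
      show "emeasure N' (- S) = 0"
        by (simp add: N'_def S_def measure_pmf.emeasure_eq_measure measure_pmf_zero_iff)
    qed (auto simp: N'_def)
  qed (use \<open>countable S\<close> AE_N in \<open>auto simp: N'_def sgl emeasure_pmf_single\<close>)
  have "(\<integral>\<^sup>+\<omega>. g (Z (Suc n) \<omega>) * indicator (E n h) \<omega> \<partial>M) = (\<integral>\<^sup>+v. g v \<partial>N)"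
    unfolding N_def
    using nn_integral_density[of "indicator (E n h)" M "\<lambda>\<omega>. g (Z (Suc n) \<omega>)"]
      measurable_compose[OF Z[of "Suc n"], of g borel]
    by (simp add: nn_integral_distr mult.commute)
  also have "\<dots> = c * (\<integral>\<^sup>+v. g v \<partial>K (h n))"
    unfolding \<open>N = N'\<close> N'_def by (simp add: nn_integral_scale_measure)
  finally show ?thesis by (simp add: c_def)
qed

text \<open>Summation of the cylinder identity over all paths that stay in \<open>A\<close> up to
  time n. There are countably many of them since \<open>A\<close> is countable, which also justifies
  exchanging sum and integral.\<close>

lemma markov_chain_killed_step:
  fixes g :: "'z \<Rightarrow> ennreal"
  assumes mc: "markov_chain_from M Z K z" and A: "countable A"
  shows "(\<integral>\<^sup>+\<omega>. g (Z (Suc n) \<omega>) * indicator {\<omega>\<in>space M. \<forall>k\<le>n. Z k \<omega> \<in> A} \<omega> \<partial>M)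
       = (\<integral>\<^sup>+\<omega>. (\<integral>\<^sup>+v. g v \<partial>K (Z n \<omega>)) * indicator {\<omega>\<in>space M. \<forall>k\<le>n. Z k \<omega> \<in> A} \<omega> \<partial>M)"
proof -
  have Z[measurable]: "Z k \<in> measurable M (count_space UNIV)" for k
    using mc by (simp add: markov_chain_from_def)
  define E where "E h = {\<omega>\<in>space M. \<forall>k\<le>n. Z k \<omega> = h k}" for h
  have E[measurable]: "E h \<in> sets M" for h unfolding E_def using sets_stays_in[OF Z, where A = "\<lambda>k. {h k}" and n = n] by simp
  \<comment> \<open>With extensional functions each path up to time n is counted exactly
    once.\<close>
  define H where "H = PiE {..n} (\<lambda>_. A)"
  have H: "countable H" unfolding H_def using A by (intro countable_PiE) auto
  have ind: "indicator {\<omega>\<in>space M. \<forall>k\<le>n. Z k \<omega> \<in> A} \<omega> = (\<integral>\<^sup>+h. indicator (E h) \<omega> \<partial>count_space H)"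
    (is "?L = ?R") if "\<omega> \<in> space M" for \<omega>
  proof -
    define h0 where "h0 = restrict (\<lambda>k. Z k \<omega>) {..n}"
    have eq: "\<omega> \<in> E h \<longleftrightarrow> h = h0" if "h \<in> H" for h
    proof
      assume "\<omega> \<in> E h"
      show "h = h0"
      proof
        fix k
        show "h k = h0 k"
          using \<open>\<omega> \<in> E h\<close> \<open>h \<in> H\<close> by (cases "k \<le> n") (auto simp: E_def H_def h0_def PiE_def extensional_def)
      qed
    qed (use \<open>\<omega> \<in> space M\<close> in \<open>simp add: E_def h0_def\<close>)
    have "?R = (\<integral>\<^sup>+h. indicator {h0} h \<partial>count_space H)"
      by (intro nn_integral_cong) (auto simp: indicator_def eq)
    also have "\<dots> = indicator H h0"
      by (cases "h0 \<in> H", subst nn_integral_indicator)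
         (auto simp: nn_integral_0_iff_AE AE_count_space indicator_def)
    also have "\<dots> = ?L" using \<open>\<omega> \<in> space M\<close> by (auto simp: indicator_def H_def h0_def PiE_iff)
    finally show ?thesis by simp
  qed
  have dec: "(\<integral>\<^sup>+\<omega>. G \<omega> * indicator {\<omega>\<in>space M. \<forall>k\<le>n. Z k \<omega> \<in> A} \<omega> \<partial>M)
      = (\<integral>\<^sup>+h. \<integral>\<^sup>+\<omega>. G \<omega> * indicator (E h) \<omega> \<partial>M \<partial>count_space H)"
    if [measurable]: "G \<in> borel_measurable M" for G
  proof -
    have "(\<integral>\<^sup>+\<omega>. G \<omega> * indicator {\<omega>\<in>space M. \<forall>k\<le>n. Z k \<omega> \<in> A} \<omega> \<partial>M)
        = (\<integral>\<^sup>+\<omega>. \<integral>\<^sup>+h. G \<omega> * indicator (E h) \<omega> \<partial>count_space H \<partial>M)"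
      by (intro nn_integral_cong) (simp add: ind nn_integral_cmult)
    also have "\<dots> = (\<integral>\<^sup>+h. \<integral>\<^sup>+\<omega>. G \<omega> * indicator (E h) \<omega> \<partial>M \<partial>count_space H)"
      using H by (intro nn_integral_count_space_nn_integral) auto
    finally show ?thesis .
  qed
  have *: "(\<integral>\<^sup>+\<omega>. (\<integral>\<^sup>+v. g v \<partial>K (Z n \<omega>)) * indicator (E h) \<omega> \<partial>M)
      = emeasure M (E h) * (\<integral>\<^sup>+v. g v \<partial>K (h n))" for h
  proof -
    have "(\<integral>\<^sup>+\<omega>. (\<integral>\<^sup>+v. g v \<partial>K (Z n \<omega>)) * indicator (E h) \<omega> \<partial>M)
      = (\<integral>\<^sup>+\<omega>. (\<integral>\<^sup>+v. g v \<partial>K (h n)) * indicator (E h) \<omega> \<partial>M)"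
      by (intro nn_integral_cong) (auto simp: E_def indicator_def)
    also have "\<dots> = (\<integral>\<^sup>+v. g v \<partial>K (h n)) * emeasure M (E h)"
      by (simp add: nn_integral_cmult_indicator)
    finally show ?thesis by (simp add: mult.commute)
  qed
  have "(\<lambda>\<omega>. \<integral>\<^sup>+v. g v \<partial>K (Z n \<omega>)) \<in> borel_measurable M"
    using measurable_compose[OF Z[of n], of "\<lambda>u. \<integral>\<^sup>+v. g v \<partial>K u" borel] by simp
  moreover have "(\<lambda>\<omega>. g (Z (Suc n) \<omega>)) \<in> borel_measurable M"
    using measurable_compose[OF Z[of "Suc n"], of g borel] by simp
  ultimately show ?thesis
    using dec[of "\<lambda>\<omega>. g (Z (Suc n) \<omega>)"] dec[of "\<lambda>\<omega>. \<integral>\<^sup>+v. g v \<partial>K (Z n \<omega>)"]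
    by (simp add: * markov_chain_cylinder_step[OF mc, of g n, folded E_def])
qed

text \<open>Iteration of the one-step inequality. \<open>C\<close> is the value credited on leaving
  \<open>A\<close>; exits at different times are disjoint events, so it is paid at most once in
  total.\<close>

lemma killed_submartingale_bound:
  fixes f :: "'z \<Rightarrow> ennreal"
  assumes mc: "markov_chain_from M Z K z" and A: "countable A" "z \<in> A"
    and sub: "\<And>u. u \<in> A \<Longrightarrow> f u \<le> (\<integral>\<^sup>+v. (if v \<in> A then f v else C) \<partial>K u)"
  shows "f z \<le> (\<integral>\<^sup>+\<omega>. f (Z n \<omega>) * indicator {\<omega>\<in>space M. \<forall>k\<le>n. Z k \<omega> \<in> A} \<omega> \<partial>M) + C"
proof -
  interpret prob_space M using mc by (simp add: markov_chain_from_def)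
  have Z[measurable]: "Z k \<in> measurable M (count_space UNIV)" for k
    using mc by (simp add: markov_chain_from_def)
  have Zf[measurable]: "(\<lambda>\<omega>. f (Z n \<omega>)) \<in> borel_measurable M" for n
    using measurable_compose[OF Z[of n], of f borel] by simp
  define E where "E n = {\<omega>\<in>space M. \<forall>k\<le>n. Z k \<omega> \<in> A}" for n
  have E[measurable]: "E n \<in> sets M" for n unfolding E_def by (rule sets_stays_in[OF Z])
  define F where "F n = (\<integral>\<^sup>+\<omega>. f (Z n \<omega>) * indicator (E n) \<omega> \<partial>M)" for n
  \<comment> \<open>The exit probability is carried along exactly and bounded by 1 only at the end;
    bounding it in each step would give a constant growing with n.\<close>
  have "f z \<le> F n + C * emeasure M (space M - E n)" for n
  proof (induction n)
    case 0
    have "AE \<omega> in M. Z 0 \<omega> = z" using mc by (simp add: markov_chain_from_def)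
    then have "AE \<omega> in M. f (Z 0 \<omega>) * indicator (E 0) \<omega> = f z"
      using AE_space by eventually_elim (use A(2) in \<open>auto simp: E_def indicator_def\<close>)
    then have "F 0 = (\<integral>\<^sup>+\<omega>. f z \<partial>M)"
      unfolding F_def by (rule nn_integral_cong_AE)
    then show ?case by (simp add: emeasure_space_1)
  next
    case (Suc n)
    have "F n \<le> (\<integral>\<^sup>+\<omega>. (\<integral>\<^sup>+v. (if v \<in> A then f v else C) \<partial>K (Z n \<omega>)) * indicator (E n) \<omega> \<partial>M)"
      unfolding F_def by (intro nn_integral_mono) (auto simp: E_def indicator_def intro: sub)
    also have "\<dots> = (\<integral>\<^sup>+\<omega>. (if Z (Suc n) \<omega> \<in> A then f (Z (Suc n) \<omega>) else C) * indicator (E n) \<omega> \<partial>M)"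
      unfolding E_def
      by (rule markov_chain_killed_step[OF mc A(1), where g = "\<lambda>v. if v \<in> A then f v else C", symmetric])
    also have "\<dots> = (\<integral>\<^sup>+\<omega>. f (Z (Suc n) \<omega>) * indicator (E (Suc n)) \<omega> + C * indicator (E n - E (Suc n)) \<omega> \<partial>M)"
      by (intro nn_integral_cong) (auto simp: E_def indicator_def le_Suc_eq)
    also have "\<dots> = F (Suc n) + C * emeasure M (E n - E (Suc n))"
      unfolding F_def by (subst nn_integral_add) (auto simp: nn_integral_cmult_indicator)
    finally have "F n \<le> F (Suc n) + C * emeasure M (E n - E (Suc n))" .
    then have "F n + C * emeasure M (space M - E n)
        \<le> F (Suc n) + C * emeasure M (E n - E (Suc n)) + C * emeasure M (space M - E n)"
      by (rule add_right_mono)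
    also have "\<dots> = F (Suc n) + C * (emeasure M (E n - E (Suc n)) + emeasure M (space M - E n))"
      by (simp add: distrib_left add.assoc)
    also have "emeasure M (E n - E (Suc n)) + emeasure M (space M - E n)
        = emeasure M ((E n - E (Suc n)) \<union> (space M - E n))"
      by (rule plus_emeasure) auto
    also have "(E n - E (Suc n)) \<union> (space M - E n) = space M - E (Suc n)"
    proof -
      have "E (Suc n) \<subseteq> E n" "E n \<subseteq> space M" by (auto simp: E_def)
      then show ?thesis by blast
    qed
    finally show ?case using Suc by (rule order_trans[rotated])
  qed
  also have "F n + C * emeasure M (space M - E n) \<le> F n + C * 1"
    by (intro add_left_mono mult_left_mono emeasure_le_1) auto
  finally show ?thesis by (simp add: F_def E_def)
qed

text \<open>Dropping survival at time n + 1 can only enlarge the left side; after that the kernel is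
  integrated without restriction and \<open>le\<close> applies at the current state, which lies in
  \<open>A\<close>.\<close>

lemma killed_growth_step:
  fixes w w' :: "'z \<Rightarrow> ennreal"
  assumes mc: "markov_chain_from M Z K z" and A: "countable A"
    and le: "\<And>u. u \<in> A \<Longrightarrow> (\<integral>\<^sup>+v. w' v \<partial>K u) \<le> \<alpha> * w u + \<beta>"
  defines "E n \<equiv> {\<omega>\<in>space M. \<forall>k\<le>n. Z k \<omega> \<in> A}"
  shows "(\<integral>\<^sup>+\<omega>. w' (Z (Suc n) \<omega>) * indicator (E (Suc n)) \<omega> \<partial>M)
    \<le> \<alpha> * (\<integral>\<^sup>+\<omega>. w (Z n \<omega>) * indicator (E n) \<omega> \<partial>M) + \<beta> * emeasure M (E n)"
proof -
  have Z[measurable]: "Z k \<in> measurable M (count_space UNIV)" for k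
    using mc by (simp add: markov_chain_from_def)
  have [measurable]: "(\<lambda>\<omega>. w (Z n \<omega>)) \<in> borel_measurable M"
    using measurable_compose[OF Z[of n], of w borel] by simp
  have E[measurable]: "E n \<in> sets M" for n unfolding E_def by (rule sets_stays_in[OF Z])
  have "(\<integral>\<^sup>+\<omega>. w' (Z (Suc n) \<omega>) * indicator (E (Suc n)) \<omega> \<partial>M)
      \<le> (\<integral>\<^sup>+\<omega>. w' (Z (Suc n) \<omega>) * indicator (E n) \<omega> \<partial>M)"
    by (intro nn_integral_mono) (auto simp: E_def indicator_def)
  also have "\<dots> = (\<integral>\<^sup>+\<omega>. (\<integral>\<^sup>+v. w' v \<partial>K (Z n \<omega>)) * indicator (E n) \<omega> \<partial>M)"
    using markov_chain_killed_step[OF mc A] by (simp add: E_def)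
  also have "\<dots> \<le> (\<integral>\<^sup>+\<omega>. \<alpha> * (w (Z n \<omega>) * indicator (E n) \<omega>) + \<beta> * indicator (E n) \<omega> \<partial>M)"
    by (intro nn_integral_mono) (auto simp: E_def indicator_def intro: le)
  also have "\<dots> = \<alpha> * (\<integral>\<^sup>+\<omega>. w (Z n \<omega>) * indicator (E n) \<omega> \<partial>M) + \<beta> * emeasure M (E n)"
    by (subst nn_integral_add) (auto simp: nn_integral_cmult nn_integral_cmult_indicator)
  finally show ?thesis .
qed

section \<open>One-step estimates\<close>

text \<open>The law of one step from height \<open>x\<close>, detached from the chain, so that the
  constants below do not depend on the state. With the moment stated as a nonnegative integral, its
  bound yields integrability as well.\<close>

locale bounded_jump =
  fixes k :: "(real \<times> 's::finite) pmf" and x p Cp :: real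
  assumes x_nonneg: "0 \<le> x" and p_gt: "2 < p"
    and support: "\<And>w. w \<in> set_pmf k \<Longrightarrow> 0 \<le> fst w"
    and moment: "(\<integral>\<^sup>+w. ennreal (\<bar>fst w - x\<bar> powr p) \<partial>k) \<le> ennreal Cp"
    and Cp_nonneg: "0 \<le> Cp"
begin

definition drift :: real where "drift = measure_pmf.expectation k (\<lambda>w. fst w - x)"

definition sqdrift :: real where "sqdrift = measure_pmf.expectation k (\<lambda>w. (fst w - x)\<^sup>2)"

lemma integrable_powr: "integrable k (\<lambda>w. \<bar>fst w - x\<bar> powr p)"
  using moment by (intro integrableI_nonneg) (auto simp: le_less_trans[OF _ ennreal_less_top])

lemma expectation_powr_le: "measure_pmf.expectation k (\<lambda>w. \<bar>fst w - x\<bar> powr p) \<le> Cp"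
proof -
  have "ennreal (measure_pmf.expectation k (\<lambda>w. \<bar>fst w - x\<bar> powr p)) \<le> ennreal Cp"
    using moment by (subst nn_integral_eq_integral[symmetric]) (auto simp: integrable_powr)
  then show ?thesis using Cp_nonneg by simp
qed

lemma abs_powr_le:
  fixes d r :: real
  assumes "0 < r" "r \<le> p"
  shows "\<bar>d\<bar> powr r \<le> 1 + \<bar>d\<bar> powr p"
proof (cases "\<bar>d\<bar> \<le> 1")
  case True
  then have "\<bar>d\<bar> powr r \<le> 1" using assms by (intro powr_le1) auto
  then show ?thesis by (simp add: add_increasing2)
next
  case False
  then have "\<bar>d\<bar> powr r \<le> \<bar>d\<bar> powr p" using assms by (intro powr_mono) auto
  then show ?thesis by simp
qed

lemma integrable_abs: "integrable k (\<lambda>w. \<bar>fst w - x\<bar>)"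
  by (rule Bochner_Integration.integrable_bound[of _ "\<lambda>w. 1 + \<bar>fst w - x\<bar> powr p"])
     (use integrable_powr abs_powr_le[of 1] p_gt in auto)

lemma integrable_jump: "integrable k (\<lambda>w. fst w - x)"
  using integrable_abs integrable_abs_iff[of "\<lambda>w. fst w - x" k] by simp

lemma sq_le: "(d::real)\<^sup>2 \<le> 1 + \<bar>d\<bar> powr p"
  using abs_powr_le[of 2 d] p_gt by (cases "d = 0") (auto simp: powr_numeral)

lemma integrable_sq: "integrable k (\<lambda>w. (fst w - x)\<^sup>2)"
  by (rule Bochner_Integration.integrable_bound[of _ "\<lambda>w. 1 + \<bar>fst w - x\<bar> powr p"])
     (use integrable_powr sq_le in auto)

lemma expectation_abs_le: "measure_pmf.expectation k (\<lambda>w. \<bar>fst w - x\<bar>) \<le> 1 + Cp"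
proof -
  have "measure_pmf.expectation k (\<lambda>w. \<bar>fst w - x\<bar>)
      \<le> measure_pmf.expectation k (\<lambda>w. 1 + \<bar>fst w - x\<bar> powr p)"
    using integrable_abs integrable_powr abs_powr_le[of 1] p_gt by (intro integral_mono) auto
  also have "\<dots> \<le> 1 + Cp"
    using integrable_powr expectation_powr_le by simp
  finally show ?thesis .
qed

lemma sqdrift_nonneg: "0 \<le> sqdrift"
  unfolding sqdrift_def by (rule integral_nonneg_AE) simp

lemma sqdrift_le: "sqdrift \<le> 1 + Cp"
proof -
  have "sqdrift \<le> measure_pmf.expectation k (\<lambda>w. 1 + \<bar>fst w - x\<bar> powr p)"
    unfolding sqdrift_def using integrable_sq integrable_powr sq_le by (intro integral_mono) auto
  also have "\<dots> \<le> 1 + Cp"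
    using integrable_powr expectation_powr_le by simp
  finally show ?thesis .
qed

lemma nn_integral_le_expectation:
  assumes "integrable k g" "\<And>w. w \<in> set_pmf k \<Longrightarrow> 0 \<le> f w" "\<And>w. w \<in> set_pmf k \<Longrightarrow> f w \<le> g w"
  shows "(\<integral>\<^sup>+w. ennreal (f w) \<partial>k) \<le> ennreal (measure_pmf.expectation k g)"
proof -
  have "(\<integral>\<^sup>+w. ennreal (f w) \<partial>k) \<le> (\<integral>\<^sup>+w. ennreal (g w) \<partial>k)"
    using assms(3) by (intro nn_integral_mono_AE) (auto simp: AE_measure_pmf_iff intro: ennreal_leI)
  also have "\<dots> = ennreal (measure_pmf.expectation k g)"
    using assms(1) order_trans[OF assms(2,3)]
    by (intro nn_integral_eq_integral) (simp_all add: AE_measure_pmf_iff)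
  finally show ?thesis .
qed

lemma expectation_le_nn_integral:
  assumes "integrable k g" "\<And>w. w \<in> set_pmf k \<Longrightarrow> g w \<le> f w"
  shows "ennreal (measure_pmf.expectation k g) \<le> (\<integral>\<^sup>+w. ennreal (f w) \<partial>k)"
proof -
  \<comment> \<open>\<open>g\<close> may be negative, so the passage to a nonnegative integral goes
    through its positive part.\<close>
  have "measure_pmf.expectation k g \<le> measure_pmf.expectation k (\<lambda>w. max 0 (g w))"
    using assms(1) by (intro integral_mono) auto
  then have "ennreal (measure_pmf.expectation k g) \<le> ennreal (measure_pmf.expectation k (\<lambda>w. max 0 (g w)))"
    by (rule ennreal_leI)
  also have "\<dots> = (\<integral>\<^sup>+w. ennreal (max 0 (g w)) \<partial>k)"
    using assms(1) by (intro nn_integral_eq_integral[symmetric]) auto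
  also have "\<dots> \<le> (\<integral>\<^sup>+w. ennreal (f w) \<partial>k)"
    using assms(2) by (intro nn_integral_mono_AE) (auto simp: AE_measure_pmf_iff max_def intro: ennreal_leI)
  finally show ?thesis .
qed

text \<open>The reason for working with x + 1: the relative jump stays strictly above -1, so all
  bases of powers are positive, also for the negative exponents that can occur in the
  corrector.\<close>

lemma relative_jump:
  assumes "w \<in> set_pmf k"
  shows "-1 < (fst w - x) / (x + 1)" "fst w + 1 = (x + 1) * (1 + (fst w - x) / (x + 1))"
  using support[OF assms] x_nonneg by (auto simp: field_simps)

text \<open>The main power is expanded to second order in the relative jump; the corrector, already
  smaller by a factor y^2, needs only order zero with a linear error. The factor
  \<open>q / 2 * y powr (q - 2)\<close> is pulled out so that the bracket can be compared directly
  with the value of \<open>b\<close> on the current line.\<close>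

lemma lyapunov_lower:
  fixes b :: "'s \<Rightarrow> real"
  assumes q: "0 < q" and C: "0 \<le> C" "\<And>t. -1 \<le> t \<Longrightarrow>
      \<bar>(1 + t) powr q - 1 - q * t - q * (q - 1) / 2 * t\<^sup>2\<bar> \<le> e * t\<^sup>2 + C * \<bar>t\<bar> powr p"
    and b: "\<And>i. 0 \<le> b i" "\<And>i. b i \<le> B"
  defines "y \<equiv> x + 1"
  shows "ennreal (y powr q + q / 2 * y powr (q - 2) * (2 * (y * drift) + (q - 1) * sqdrift
        - 2 / q * e * sqdrift - 2 / q * C * Cp * y powr (2 - p)
        + (\<Sum>j\<in>UNIV. b j * measure_pmf.prob k {w. snd w = j}) - B * (\<bar>q - 2\<bar> + 1) * (1 + Cp) * inverse y))
    \<le> (\<integral>\<^sup>+w. ennreal ((fst w + 1) powr q + q / 2 * b (snd w) * (fst w + 1) powr (q - 2)) \<partial>k)"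
    (is "ennreal ?L \<le> _")
proof -
  have y: "1 \<le> y" using x_nonneg by (simp add: y_def)
  define D where "D w = fst w - x" for w :: "real \<times> 's"
  \<comment> \<open>A pointwise minorant of the integrand whose expectation involves only
    \<open>drift\<close>, \<open>sqdrift\<close>, the line probabilities and the absolute moments of
    order 1 and \<open>p\<close>.\<close>
  define g where "g w = y powr q * (1 + q / y * D w + (q * (q - 1) / 2 - e) / y\<^sup>2 * (D w)\<^sup>2
      - C * y powr (- p) * \<bar>D w\<bar> powr p) + q / 2 * y powr (q - 2) * (b (snd w)
      - B * (\<bar>q - 2\<bar> + 1) / y * \<bar>D w\<bar>)" for w
  have B: "0 \<le> B" using b order_trans by blast
  have int: "integrable k D" "integrable k (\<lambda>w. (D w)\<^sup>2)" "integrable k (\<lambda>w. \<bar>D w\<bar>)"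
      "integrable k (\<lambda>w. \<bar>D w\<bar> powr p)" "integrable k (\<lambda>w. b (snd w))"
    unfolding D_def using integrable_jump integrable_sq integrable_abs integrable_powr
    by (auto intro!: measure_pmf.integrable_const_bound[where B=B] simp: b)
  have Eb: "measure_pmf.expectation k (\<lambda>w. b (snd w)) = (\<Sum>j\<in>UNIV. b j * measure_pmf.prob k {w. snd w = j})"
  proof -
    have "measure_pmf.expectation k (\<lambda>w. b (snd w)) = measure_pmf.expectation (map_pmf snd k) b"
      by simp
    also have "\<dots> = (\<Sum>j\<in>UNIV. b j * pmf (map_pmf snd k) j)"
      by (subst integral_measure_pmf[of UNIV]) (auto simp: mult.commute)
    finally show ?thesis by (simp add: pmf_map vimage_def)
  qed
  have "?L \<le> measure_pmf.expectation k g"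
  proof -
    have Eg: "measure_pmf.expectation k g = y powr q * (1 + q / y * drift + (q * (q - 1) / 2 - e) / y\<^sup>2 * sqdrift
        - C * y powr (- p) * measure_pmf.expectation k (\<lambda>w. \<bar>D w\<bar> powr p))
        + q / 2 * y powr (q - 2) * (measure_pmf.expectation k (\<lambda>w. b (snd w))
        - B * (\<bar>q - 2\<bar> + 1) / y * measure_pmf.expectation k (\<lambda>w. \<bar>D w\<bar>))"
      unfolding g_def drift_def sqdrift_def D_def[symmetric] using int by simp
    have "C * y powr (- p) * measure_pmf.expectation k (\<lambda>w. \<bar>D w\<bar> powr p) \<le> C * y powr (- p) * Cp"
      using C expectation_powr_le by (intro mult_left_mono) (auto simp: D_def)
    moreover have "B * (\<bar>q - 2\<bar> + 1) / y * measure_pmf.expectation k (\<lambda>w. \<bar>D w\<bar>)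
        \<le> B * (\<bar>q - 2\<bar> + 1) / y * (1 + Cp)"
      using B y expectation_abs_le by (intro mult_left_mono) (auto simp: D_def)
    ultimately have "y powr q * (1 + q / y * drift + (q * (q - 1) / 2 - e) / y\<^sup>2 * sqdrift - C * y powr (- p) * Cp)
        + q / 2 * y powr (q - 2) * (measure_pmf.expectation k (\<lambda>w. b (snd w))
        - B * (\<bar>q - 2\<bar> + 1) / y * (1 + Cp)) \<le> measure_pmf.expectation k g"
      unfolding Eg using q y by (intro add_mono mult_left_mono[of _ _ "y powr q"] mult_left_mono[of _ _ "q / 2 * y powr (q - 2)"]
        diff_left_mono) auto
    moreover have "y powr q * (1 + q / y * drift + (q * (q - 1) / 2 - e) / y\<^sup>2 * sqdrift - C * y powr (- p) * Cp)
        = y powr q + y powr (q - 2) * (q * (y * drift) + (q * (q - 1) / 2 - e) * sqdrift - C * Cp * y powr (2 - p))"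
    proof -
      have 1: "y powr q = y powr (q - 2) * y\<^sup>2"
        using y by (simp add: powr_diff powr_numeral)
      have 2: "y powr (2 - p) = y powr (- p) * y\<^sup>2"
        using y by (simp add: powr_diff powr_minus powr_numeral divide_simps)
      show ?thesis
        unfolding 1 2 using y by (simp add: field_simps power2_eq_square)
    qed
    moreover have "?L = y powr q + y powr (q - 2) * (q * (y * drift) + (q * (q - 1) / 2 - e) * sqdrift
        - C * Cp * y powr (2 - p)) + q / 2 * y powr (q - 2) * (measure_pmf.expectation k (\<lambda>w. b (snd w))
        - B * (\<bar>q - 2\<bar> + 1) / y * (1 + Cp))"
      unfolding Eb using q y by (simp add: field_simps)
    ultimately show ?thesis by linarith
  qed
  then have "ennreal ?L \<le> ennreal (measure_pmf.expectation k g)" by (rule ennreal_leI)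
  also have "\<dots> \<le> (\<integral>\<^sup>+w. ennreal ((fst w + 1) powr q + q / 2 * b (snd w) * (fst w + 1) powr (q - 2)) \<partial>k)"
  proof (rule expectation_le_nn_integral)
    show "integrable k g" unfolding g_def using int by auto
    fix w assume w: "w \<in> set_pmf k"
    define t where "t = D w / y"
    have t: "-1 < t" "fst w + 1 = y * (1 + t)"
      using relative_jump[OF w] unfolding t_def D_def y_def by auto
    have t2: "t\<^sup>2 = (D w)\<^sup>2 / y\<^sup>2" by (simp add: t_def power_divide)
    have tp: "\<bar>t\<bar> powr p = y powr (- p) * \<bar>D w\<bar> powr p"
      using y by (simp add: t_def abs_divide powr_divide powr_minus_divide)
    have ta: "\<bar>t\<bar> = \<bar>D w\<bar> / y" using y by (simp add: t_def abs_divide)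
    have "1 + q * t + (q * (q - 1) / 2 - e) * t\<^sup>2 - C * \<bar>t\<bar> powr p \<le> (1 + t) powr q"
      using C(2)[of t] t(1) by (simp add: algebra_simps abs_le_iff)
    then have "y powr q * (1 + q * t + (q * (q - 1) / 2 - e) * t\<^sup>2 - C * \<bar>t\<bar> powr p)
        \<le> y powr q * (1 + t) powr q"
      by (intro mult_left_mono) auto
    also have "\<dots> = (fst w + 1) powr q" using t y by (simp add: powr_mult)
    finally have 1: "y powr q * (1 + q * t + (q * (q - 1) / 2 - e) * t\<^sup>2 - C * \<bar>t\<bar> powr p) \<le> (fst w + 1) powr q" .
    \<comment> \<open>In the error term \<open>b\<close> is replaced by its bound \<open>B\<close>,
      which decouples the next line from the size of the jump.\<close>
    have "b (snd w) - B * (\<bar>q - 2\<bar> + 1) * \<bar>t\<bar> \<le> b (snd w) * (1 - (\<bar>q - 2\<bar> + 1) * \<bar>t\<bar>)"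
      using mult_right_mono[OF b(2)[of "snd w"], of "(\<bar>q - 2\<bar> + 1) * \<bar>t\<bar>"] by (simp add: right_diff_distrib mult.assoc)
    also have "\<dots> \<le> b (snd w) * (1 + t) powr (q - 2)"
      using powr_Bernoulli[OF t(1)] b(1) by (rule mult_left_mono)
    finally have "q / 2 * y powr (q - 2) * (b (snd w) - B * (\<bar>q - 2\<bar> + 1) * \<bar>t\<bar>)
       \<le> q / 2 * y powr (q - 2) * (b (snd w) * (1 + t) powr (q - 2))"
      using q by (intro mult_left_mono) auto
    also have "\<dots> = q / 2 * b (snd w) * (fst w + 1) powr (q - 2)"
      using t y by (simp add: powr_mult)
    finally have 2: "q / 2 * y powr (q - 2) * (b (snd w) - B * (\<bar>q - 2\<bar> + 1) * \<bar>t\<bar>)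
       \<le> q / 2 * b (snd w) * (fst w + 1) powr (q - 2)" .
    have "g w = y powr q * (1 + q * t + (q * (q - 1) / 2 - e) * t\<^sup>2 - C * \<bar>t\<bar> powr p)
        + q / 2 * y powr (q - 2) * (b (snd w) - B * (\<bar>q - 2\<bar> + 1) * \<bar>t\<bar>)"
      unfolding g_def t2 tp using y by (simp add: ta) (simp add: t_def)
    then show "g w \<le> (fst w + 1) powr q + q / 2 * b (snd w) * (fst w + 1) powr (q - 2)"
      using 1 2 by linarith
  qed
  finally show ?thesis .
qed

text \<open>The same expansion from above. Only the order of the correction matters here, so the
  quadratic slack may be 1; the term with the p-th moment is harmless because y^(2-p) \<le>
  1.\<close>

lemma powr_upper:
  assumes q: "2 \<le> q" "q \<le> p" and C: "0 \<le> C" "\<And>t. -1 \<le> t \<Longrightarrow>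
      \<bar>(1 + t) powr q - 1 - q * t - q * (q - 1) / 2 * t\<^sup>2\<bar> \<le> 1 * t\<^sup>2 + C * \<bar>t\<bar> powr p"
    and C1: "(x + 1) * drift \<le> C1"
  shows "(\<integral>\<^sup>+w. ennreal ((fst w + 1) powr q) \<partial>k) \<le> ennreal ((x + 1) powr q
      + (q * C1 + (q * (q - 1) / 2 + 1) * (1 + Cp) + C * Cp) * (x + 1) powr (q - 2))"
proof -
  define y where "y = x + 1"
  have y: "1 \<le> y" using x_nonneg by (simp add: y_def)
  define D where "D w = fst w - x" for w :: "real \<times> 's"
  define g where "g w = y powr q * (1 + q / y * D w + (q * (q - 1) / 2 + 1) / y\<^sup>2 * (D w)\<^sup>2
      + C * y powr (- p) * \<bar>D w\<bar> powr p)" for w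
  have int: "integrable k D" "integrable k (\<lambda>w. (D w)\<^sup>2)" "integrable k (\<lambda>w. \<bar>D w\<bar> powr p)"
    unfolding D_def using integrable_jump integrable_sq integrable_powr by auto
  have "(\<integral>\<^sup>+w. ennreal ((fst w + 1) powr q) \<partial>k) \<le> ennreal (measure_pmf.expectation k g)"
  proof (rule nn_integral_le_expectation)
    show "integrable k g" unfolding g_def using int by auto
    fix w assume w: "w \<in> set_pmf k"
    define t where "t = D w / y"
    have t: "-1 < t" "fst w + 1 = y * (1 + t)"
      using relative_jump[OF w] unfolding t_def D_def y_def by auto
    have t2: "t\<^sup>2 = (D w)\<^sup>2 / y\<^sup>2" by (simp add: t_def power_divide)
    have tp: "\<bar>t\<bar> powr p = y powr (- p) * \<bar>D w\<bar> powr p"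
      using y by (simp add: t_def abs_divide powr_divide powr_minus_divide)
    have "(1 + t) powr q \<le> 1 + q * t + (q * (q - 1) / 2 + 1) * t\<^sup>2 + C * \<bar>t\<bar> powr p"
      using C(2)[of t] t(1) by (simp add: algebra_simps abs_le_iff)
    then have "y powr q * (1 + t) powr q
        \<le> y powr q * (1 + q * t + (q * (q - 1) / 2 + 1) * t\<^sup>2 + C * \<bar>t\<bar> powr p)"
      by (intro mult_left_mono) auto
    also have "\<dots> = g w"
      unfolding g_def t2 tp by (simp add: t_def)
    finally show "(fst w + 1) powr q \<le> g w" using t y by (simp add: powr_mult)
  qed simp
  moreover have "measure_pmf.expectation k g \<le> y powr q
      + (q * C1 + (q * (q - 1) / 2 + 1) * (1 + Cp) + C * Cp) * y powr (q - 2)"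
  proof -
    have yq: "y powr q = y powr (q - 2) * y\<^sup>2"
      using y by (simp add: powr_diff powr_numeral)
    have "measure_pmf.expectation k g = y powr q * (1 + q / y * drift + (q * (q - 1) / 2 + 1) / y\<^sup>2 * sqdrift
        + C * y powr (- p) * measure_pmf.expectation k (\<lambda>w. \<bar>D w\<bar> powr p))"
      unfolding g_def drift_def sqdrift_def D_def[symmetric] using int by simp
    also have "\<dots> = y powr q + y powr (q - 2) * (q * (y * drift) + (q * (q - 1) / 2 + 1) * sqdrift
        + C * ((y\<^sup>2 * y powr (- p)) * measure_pmf.expectation k (\<lambda>w. \<bar>D w\<bar> powr p)))"
      using y unfolding yq by (simp add: field_simps power2_eq_square)
    also have "\<dots> \<le> y powr q + y powr (q - 2) * (q * C1 + (q * (q - 1) / 2 + 1) * (1 + Cp) + C * (1 * Cp))"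
    proof (intro add_left_mono mult_left_mono add_mono)
      show "y * drift \<le> C1" using C1 by (simp add: y_def)
      show "y\<^sup>2 * y powr (- p) * measure_pmf.expectation k (\<lambda>w. \<bar>D w\<bar> powr p) \<le> 1 * Cp"
      proof (rule mult_mono)
        have "y\<^sup>2 * y powr (- p) = y powr (2 - p)"
          using y by (simp add: powr_diff powr_minus powr_numeral divide_simps)
        also have "\<dots> \<le> y powr 0" using y p_gt by (intro powr_mono) auto
        finally show "y\<^sup>2 * y powr (- p) \<le> 1" using y by simp
        show "measure_pmf.expectation k (\<lambda>w. \<bar>D w\<bar> powr p) \<le> Cp"
          unfolding D_def by (rule expectation_powr_le)
      qed auto
    qed (use sqdrift_le q C in auto)
    finally show ?thesis by (simp add: algebra_simps)
  qed
  ultimately show ?thesis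
    unfolding y_def by (meson ennreal_leI order_trans)
qed

text \<open>By concavity the power lies below its tangent at u = (x + 1)^2 + N. The increment of the
  base is 2 y D + D^2 + 1, whose mean is bounded above by the drift assumption and the second
  moment.\<close>

lemma concave_upper:
  assumes \<theta>: "0 < \<theta>" "\<theta> \<le> 1" and N: "0 < N" and C1: "(x + 1) * drift \<le> C1" "0 \<le> C1"
  shows "(\<integral>\<^sup>+w. ennreal (((fst w + 1)\<^sup>2 + (N + 1)) powr \<theta>) \<partial>k)
    \<le> ennreal (((x + 1)\<^sup>2 + N) powr \<theta> + (2 * C1 + Cp + 2) * ((x + 1)\<^sup>2 + N) powr (\<theta> - 1))"
proof -
  define y where "y = x + 1"
  define u where "u = y\<^sup>2 + N"
  have u: "0 < u" using N by (simp add: u_def add_nonneg_pos)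
  define D where "D w = fst w - x" for w :: "real \<times> 's"
  define g where "g w = u powr \<theta> + \<theta> * u powr (\<theta> - 1) * (2 * y * D w + (D w)\<^sup>2 + 1)" for w
  have int: "integrable k D" "integrable k (\<lambda>w. (D w)\<^sup>2)"
    unfolding D_def using integrable_jump integrable_sq by auto
  have "(\<integral>\<^sup>+w. ennreal (((fst w + 1)\<^sup>2 + (N + 1)) powr \<theta>) \<partial>k) \<le> ennreal (measure_pmf.expectation k g)"
  proof (rule nn_integral_le_expectation)
    show "integrable k g" unfolding g_def using int by auto
    fix w :: "real \<times> 's"
    define v where "v = (fst w + 1)\<^sup>2 + (N + 1)"
    have v: "0 < v" unfolding v_def using N by (simp add: add_nonneg_pos)
    have uv: "v - u = 2 * y * D w + (D w)\<^sup>2 + 1"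
      unfolding u_def v_def D_def y_def by (simp add: power2_eq_square algebra_simps)
    \<comment> \<open>The weighted inequality of arithmetic and geometric means for v / u and 1,
      with weights \<theta> and 1 - \<theta>, is the tangent inequality.\<close>
    have "v powr \<theta> = u powr \<theta> * ((v / u) powr \<theta> * 1 powr (1 - \<theta>))"
      using u v by (simp add: powr_divide)
    also have "\<dots> \<le> u powr \<theta> * (\<theta> * (v / u) + (1 - \<theta>) * 1)"
      using u v \<theta> by (intro mult_left_mono Youngs_inequality_0) auto
    also have "\<dots> = u powr \<theta> + \<theta> * u powr (\<theta> - 1) * (v - u)"
      using u by (simp add: powr_diff field_simps)
    finally show "v powr \<theta> \<le> g w" unfolding g_def uv .
  qed simp
  moreover have "measure_pmf.expectation k g \<le> u powr \<theta> + (2 * C1 + Cp + 2) * u powr (\<theta> - 1)"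
  proof -
    have "measure_pmf.expectation k g = u powr \<theta> + \<theta> * u powr (\<theta> - 1) * (2 * (y * drift) + sqdrift + 1)"
      unfolding g_def drift_def sqdrift_def D_def[symmetric] using int by simp
    also have "\<dots> \<le> u powr \<theta> + \<theta> * u powr (\<theta> - 1) * (2 * C1 + (1 + Cp) + 1)"
      using C1 sqdrift_le \<theta> by (intro add_left_mono mult_left_mono add_mono) (auto simp: y_def)
    also have "\<dots> \<le> u powr \<theta> + 1 * u powr (\<theta> - 1) * (2 * C1 + (1 + Cp) + 1)"
      using C1(2) Cp_nonneg \<theta> by (intro add_left_mono mult_right_mono) auto
    finally show ?thesis by (simp add: algebra_simps)
  qed
  ultimately show ?thesis
    unfolding u_def y_def by (meson ennreal_leI order_trans)
qed

end

text \<open>The threshold is u = N / \<kappa>: above it the lower power is a small multiple of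
  u^\<theta> / N, below it the lower power has order at most N^(\<theta> - 1).\<close>

lemma powr_diff_one_le:
  fixes u N \<kappa> \<theta> :: real
  assumes "0 < u" "0 < N" "0 < \<kappa>" "1 \<le> \<theta>"
  shows "u powr (\<theta> - 1) \<le> \<kappa> / N * u powr \<theta> + (1 / \<kappa>) powr (\<theta> - 1) * N powr (\<theta> - 1)"
proof (cases "N / \<kappa> \<le> u")
  case True
  then have "1 \<le> \<kappa> / N * u" using assms by (simp add: field_simps)
  then have "1 * u powr (\<theta> - 1) \<le> \<kappa> / N * u * u powr (\<theta> - 1)" by (rule mult_right_mono) simp
  also have "\<dots> = \<kappa> / N * u powr \<theta>" using assms by (simp add: powr_diff)
  finally show ?thesis by (simp add: add_increasing2)
next
  case False
  then have "u powr (\<theta> - 1) \<le> (1 / \<kappa> * N) powr (\<theta> - 1)" using assms by (intro powr_mono2) auto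
  also have "\<dots> = (1 / \<kappa>) powr (\<theta> - 1) * N powr (\<theta> - 1)" using assms by (simp add: powr_divide)
  finally show ?thesis using assms by (simp add: add_increasing)
qed

section \<open>Growth of the killed expectation\<close>

text \<open>With y = x + 1 and N = n + 1, the function is (y^2 + N)^\<theta> for \<theta> \<le> 1,
  treated by concavity, and y^(2 * \<theta>) + N^\<theta> for \<theta> > 1, treated by the Taylor
  bound, which is available because 2 * \<theta> \<le> p. The last property trades the surplus
  \<theta> - \<theta>' in the exponent for decay in n.\<close>

lemma growth_function_exists:
  fixes p Cp \<theta> \<theta>' \<kappa> C1 :: real
  assumes \<theta>: "0 < \<theta>" "\<theta> \<le> p / 2" and p: "2 < p" and \<theta>': "0 < \<theta>'" "\<theta>' < \<theta>"
    and \<kappa>: "0 < \<kappa>" and C1: "0 \<le> C1" and Cp: "0 \<le> Cp"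
  obtains w :: "nat \<Rightarrow> real \<Rightarrow> real" and C where "0 \<le> C" "\<And>n x. 0 \<le> w n x"
    "\<And>(k :: (real \<times> 's::finite) pmf) x n. bounded_jump k x p Cp \<Longrightarrow>
        (x + 1) * bounded_jump.drift k x \<le> C1 \<Longrightarrow>
        (\<integral>\<^sup>+v. ennreal (w (Suc n) (fst v)) \<partial>k)
          \<le> ennreal ((1 + \<kappa> / real (Suc n)) * w n x + C * real (Suc n) powr (\<theta> - 1))"
    "\<And>n x. 0 \<le> x \<Longrightarrow> (x + 1) powr (2 * \<theta>') \<le> real (Suc n) powr (\<theta>' - \<theta>) * w n x"
proof (cases "\<theta> \<le> 1")
  case True
  define w where "w n x = ((x + 1)\<^sup>2 + real (Suc n)) powr \<theta>" for n x
  define C where "C = 2 * C1 + Cp + 2"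
  show thesis
  proof (rule that[of C w])
    fix k :: "(real \<times> 's) pmf" and x n
    assume bj: "bounded_jump k x p Cp" and d: "(x + 1) * bounded_jump.drift k x \<le> C1"
    define u where "u = (x + 1)\<^sup>2 + real (Suc n)"
    have u: "real (Suc n) \<le> u" by (simp add: u_def)
    have "(\<integral>\<^sup>+v. ennreal (w (Suc n) (fst v)) \<partial>k) \<le> ennreal (u powr \<theta> + C * u powr (\<theta> - 1))"
      using bounded_jump.concave_upper[OF bj \<theta>(1) True _ d C1, of "real (Suc n)"]
      by (simp add: w_def C_def u_def add_ac)
    also have "\<dots> \<le> ennreal ((1 + \<kappa> / real (Suc n)) * w n x + C * real (Suc n) powr (\<theta> - 1))"
    proof (intro ennreal_leI add_mono mult_left_mono)
      show "u powr \<theta> \<le> (1 + \<kappa> / real (Suc n)) * w n x"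
        unfolding w_def u_def[symmetric] using \<kappa> by (simp add: distrib_right)
      \<comment> \<open>Here the time shift in the base pays off: u \<ge> n + 1, and the exponent is
        nonpositive.\<close>
      show "u powr (\<theta> - 1) \<le> real (Suc n) powr (\<theta> - 1)"
        using True u by (intro powr_mono2') auto
      show "0 \<le> C" using C1 Cp by (simp add: C_def)
    qed
    finally show "(\<integral>\<^sup>+v. ennreal (w (Suc n) (fst v)) \<partial>k)
          \<le> ennreal ((1 + \<kappa> / real (Suc n)) * w n x + C * real (Suc n) powr (\<theta> - 1))" .
  next
    fix n and x :: real assume x: "0 \<le> x"
    define u where "u = (x + 1)\<^sup>2 + real (Suc n)"
    have u: "real (Suc n) \<le> u" by (simp add: u_def)
    have "(x + 1) powr (2 * \<theta>') = ((x + 1)\<^sup>2) powr \<theta>'"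
      using x by (simp add: powr_powr[symmetric] powr_numeral)
    also have "\<dots> \<le> u powr \<theta>'" using \<theta>' by (intro powr_mono2) (auto simp: u_def)
    also have "\<dots> = u powr (\<theta>' - \<theta>) * u powr \<theta>" by (simp add: powr_add[symmetric])
    also have "\<dots> \<le> real (Suc n) powr (\<theta>' - \<theta>) * u powr \<theta>"
      using u \<theta>' by (intro mult_right_mono powr_mono2') auto
    finally show "(x + 1) powr (2 * \<theta>') \<le> real (Suc n) powr (\<theta>' - \<theta>) * w n x"
      by (simp add: w_def u_def)
  qed (use C1 Cp in \<open>auto simp: w_def C_def\<close>)
next
  case False
  then have t1: "1 \<le> \<theta>" by simp
  obtain T where T: "0 \<le> T" "\<And>t. -1 \<le> t \<Longrightarrow>
      \<bar>(1 + t) powr (2 * \<theta>) - 1 - 2 * \<theta> * t - 2 * \<theta> * (2 * \<theta> - 1) / 2 * t\<^sup>2\<bar> \<le> 1 * t\<^sup>2 + T * \<bar>t\<bar> powr p"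
    using powr_taylor2[of "2 * \<theta>" p 1] \<theta> p by auto
  define w where "w n x = (x + 1) powr (2 * \<theta>) + real (Suc n) powr \<theta>" for n x
  define C3 where "C3 = 2 * \<theta> * C1 + (2 * \<theta> * (2 * \<theta> - 1) / 2 + 1) * (1 + Cp) + T * Cp"
  have C3: "0 \<le> C3" unfolding C3_def using t1 C1 Cp T(1)
    by (intro add_nonneg_nonneg mult_nonneg_nonneg divide_nonneg_nonneg) auto
  \<comment> \<open>The small multiple from \<open>powr_diff_one_le\<close> gets multiplied by
    \<open>C3\<close>; this choice keeps the product below \<kappa>.\<close>
  define \<kappa>' where "\<kappa>' = \<kappa> / (C3 + 1)"
  have \<kappa>': "0 < \<kappa>'" "C3 * \<kappa>' \<le> \<kappa>" using C3 \<kappa> by (auto simp: \<kappa>'_def field_simps)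
  define C where "C = C3 * (1 / \<kappa>') powr (\<theta> - 1) + (\<theta> + 1) * 2 powr (\<theta> - 1)"
  show thesis
  proof (rule that[of C w])
    fix k :: "(real \<times> 's) pmf" and x n
    assume bj: "bounded_jump k x p Cp" and d: "(x + 1) * bounded_jump.drift k x \<le> C1"
    define N where "N = real (Suc n)"
    have N: "1 \<le> N" "real (Suc (Suc n)) = N + 1" by (auto simp: N_def)
    have x: "0 \<le> x" using bj by (simp add: bounded_jump_def)
    have "(\<integral>\<^sup>+v. ennreal (w (Suc n) (fst v)) \<partial>k)
        = (\<integral>\<^sup>+v. ennreal ((fst v + 1) powr (2 * \<theta>)) + ennreal ((N + 1) powr \<theta>) \<partial>k)"
      unfolding w_def N(2) by simp
    also have "\<dots> = (\<integral>\<^sup>+v. ennreal ((fst v + 1) powr (2 * \<theta>)) \<partial>k) + ennreal ((N + 1) powr \<theta>)"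
      by (subst nn_integral_add) (auto simp: measure_pmf.emeasure_space_1)
    also have "\<dots> \<le> ennreal ((x + 1) powr (2 * \<theta>) + C3 * (x + 1) powr (2 * \<theta> - 2)) + ennreal ((N + 1) powr \<theta>)"
      unfolding C3_def using \<theta> t1
      by (intro add_right_mono bounded_jump.powr_upper[OF bj _ _ T d]) auto
    also have "\<dots> = ennreal ((x + 1) powr (2 * \<theta>) + C3 * (x + 1) powr (2 * \<theta> - 2) + (N + 1) powr \<theta>)"
      using C3 by (simp add: ennreal_plus)
    also have "\<dots> \<le> ennreal ((1 + \<kappa> / N) * w n x + C * N powr (\<theta> - 1))"
    proof (rule ennreal_leI)
      have p1: "(x + 1) powr (2 * \<theta> - 2) = ((x + 1)\<^sup>2) powr (\<theta> - 1)"
        using x powr_powr[of "x + 1" 2 "\<theta> - 1"] by (simp add: powr_numeral right_diff_distrib)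
      have p2: "(x + 1) powr (2 * \<theta>) = ((x + 1)\<^sup>2) powr \<theta>"
        using x powr_powr[of "x + 1" 2 \<theta>] by (simp add: powr_numeral)
      have "C3 * (x + 1) powr (2 * \<theta> - 2)
          \<le> C3 * (\<kappa>' / N * (x + 1) powr (2 * \<theta>) + (1 / \<kappa>') powr (\<theta> - 1) * N powr (\<theta> - 1))"
        unfolding p1 p2 using C3 x N \<kappa>' t1 by (intro mult_left_mono powr_diff_one_le) auto
      also have "\<dots> \<le> \<kappa> / N * (x + 1) powr (2 * \<theta>) + C3 * (1 / \<kappa>') powr (\<theta> - 1) * N powr (\<theta> - 1)"
      proof -
        have "C3 * \<kappa>' * (1 / N * (x + 1) powr (2 * \<theta>)) \<le> \<kappa> * (1 / N * (x + 1) powr (2 * \<theta>))"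
          using \<kappa>' N by (intro mult_right_mono) auto
        then show ?thesis by (simp add: algebra_simps)
      qed
      finally have 1: "C3 * (x + 1) powr (2 * \<theta> - 2)
        \<le> \<kappa> / N * (x + 1) powr (2 * \<theta>) + C3 * (1 / \<kappa>') powr (\<theta> - 1) * N powr (\<theta> - 1)" .
      \<comment> \<open>Bernoulli at t = -1 / (N + 1), where (N + 1) (1 + t) = N, bounds the
        increment of N^\<theta>; then N + 1 \<le> 2 N.\<close>
      have "(N + 1) powr \<theta> * (1 - (\<theta> + 1) / (N + 1)) \<le> (N + 1) powr \<theta> * (1 + - 1 / (N + 1)) powr \<theta>"
        using powr_Bernoulli[of "- 1 / (N + 1)" \<theta>] N t1 by (intro mult_left_mono) (auto simp: abs_divide)
      also have "\<dots> = ((N + 1) * (1 + - 1 / (N + 1))) powr \<theta>"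
        using N by (intro powr_mult[symmetric]) 
      also have "(N + 1) * (1 + - 1 / (N + 1)) = N"
        using N by (simp add: field_simps)
      finally have "(N + 1) powr \<theta> \<le> N powr \<theta> + (\<theta> + 1) * (N + 1) powr (\<theta> - 1)"
        using N by (simp add: powr_diff algebra_simps)
      also have "\<dots> \<le> N powr \<theta> + (\<theta> + 1) * (2 * N) powr (\<theta> - 1)"
        using N t1 by (intro add_left_mono mult_left_mono powr_mono2) auto
      finally have 2: "(N + 1) powr \<theta> \<le> N powr \<theta> + (\<theta> + 1) * 2 powr (\<theta> - 1) * N powr (\<theta> - 1)"
        using N by (simp add: powr_mult)
      have "0 \<le> \<kappa> / N * N powr \<theta>" using \<kappa> N by simp
      then show "(x + 1) powr (2 * \<theta>) + C3 * (x + 1) powr (2 * \<theta> - 2) + (N + 1) powr \<theta>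
          \<le> (1 + \<kappa> / N) * w n x + C * N powr (\<theta> - 1)"
        using 1 2 unfolding w_def C_def N_def[symmetric] distrib_right distrib_left by linarith
    qed
    finally show "(\<integral>\<^sup>+v. ennreal (w (Suc n) (fst v)) \<partial>k)
          \<le> ennreal ((1 + \<kappa> / real (Suc n)) * w n x + C * real (Suc n) powr (\<theta> - 1))"
      unfolding N_def .
  next
    fix n and x :: real assume x: "0 \<le> x"
    define N where "N = real (Suc n)"
    have N: "1 \<le> N" by (auto simp: N_def)
    define u where "u = (x + 1)\<^sup>2"
    have u: "0 < u" using x by (simp add: u_def)
    have p2: "(x + 1) powr (2 * r) = u powr r" for r
      using x powr_powr[of "x + 1" 2 r] by (simp add: powr_numeral u_def)
    \<comment> \<open>The larger of y^2 and N alone carries the estimate, through its own summand of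
      \<open>w\<close>.\<close>
    show "(x + 1) powr (2 * \<theta>') \<le> real (Suc n) powr (\<theta>' - \<theta>) * w n x"
    proof (cases "N \<le> u")
      case True
      have "u powr \<theta>' = u powr (\<theta>' - \<theta>) * u powr \<theta>" by (simp add: powr_add[symmetric])
      also have "\<dots> \<le> N powr (\<theta>' - \<theta>) * (u powr \<theta> + N powr \<theta>)"
        using True N \<theta>' by (intro mult_mono powr_mono2') auto
      finally show ?thesis by (simp add: w_def p2 N_def)
    next
      case False
      then have "u powr \<theta>' \<le> N powr \<theta>'" using u \<theta>' by (intro powr_mono2) auto
      also have "\<dots> = N powr (\<theta>' - \<theta>) * N powr \<theta>" by (simp add: powr_add[symmetric])
      also have "\<dots> \<le> N powr (\<theta>' - \<theta>) * (u powr \<theta> + N powr \<theta>)"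
        by (intro mult_left_mono) auto
      finally show ?thesis by (simp add: w_def p2 N_def)
    qed
  qed (use C3 t1 in \<open>auto simp: w_def C_def\<close>)
qed

text \<open>Rests on ln (1 + u) \<ge> u / 2 for u = 1 / N \<le> 1. The factor 2 lost there is why
  the rate 2 * \<kappa> needs the exponent 4 * \<kappa>.\<close>

lemma powr_Suc_ge:
  fixes \<kappa> N :: real
  assumes "0 < \<kappa>" "1 \<le> N"
  shows "(1 + 2 * \<kappa> / N) * N powr (4 * \<kappa>) \<le> (N + 1) powr (4 * \<kappa>)"
proof -
  define u where "u = 1 / N"
  have u: "0 < u" "u \<le> 1" using assms by (auto simp: u_def)
  have "ln (1 / (1 + u)) \<le> 1 / (1 + u) - 1" using u by (intro ln_le_minus_one) auto
  then have "u / (1 + u) \<le> ln (1 + u)" using u by (simp add: ln_div field_simps)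
  moreover have "u / 2 \<le> u / (1 + u)" using u frac_le[of u u "1 + u" 2] by simp
  ultimately have "u / 2 \<le> ln (1 + u)" by linarith
  then have "2 * \<kappa> * u \<le> 4 * \<kappa> * ln (1 + u)" using assms(1) by (simp add: field_simps)
  then have "1 + 2 * \<kappa> * u \<le> 1 + 4 * \<kappa> * ln (1 + u)" by simp
  also have "\<dots> \<le> (1 + u) powr (4 * \<kappa>)"
    using u exp_ge_add_one_self[of "4 * \<kappa> * ln (1 + u)"] by (simp add: powr_def mult.commute)
  finally have "(1 + 2 * \<kappa> * u) * N powr (4 * \<kappa>) \<le> (1 + u) powr (4 * \<kappa>) * N powr (4 * \<kappa>)"
    by (rule mult_right_mono) simp
  also have "\<dots> = ((1 + u) * N) powr (4 * \<kappa>)" using u assms by (intro powr_mult[symmetric])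
  also have "(1 + u) * N = N + 1" using assms by (simp add: u_def field_simps)
  finally show ?thesis by (simp add: u_def)
qed

text \<open>By the tail bound the source term of the recursion is at most C D / N, as N^(\<theta> -
  1) N^(-\<theta>) = 1 / N. For large B it is absorbed by another \<kappa> B / N, so the rate
  \<kappa> doubles and B N^(4 * \<kappa>) is a supersolution.\<close>

lemma killed_growth_bound:
  fixes w :: "nat \<Rightarrow> 'z \<Rightarrow> real" and \<kappa> \<theta> C D :: real
  assumes mc: "markov_chain_from M Z K z" and A: "countable A" "z \<in> A"
    and nonneg: "0 < \<kappa>" "0 \<le> C" "0 \<le> D" "\<And>n u. 0 \<le> w n u"
    and step: "\<And>n u. u \<in> A \<Longrightarrow> (\<integral>\<^sup>+v. ennreal (w (Suc n) v) \<partial>K u)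
        \<le> ennreal ((1 + \<kappa> / real (Suc n)) * w n u + C * real (Suc n) powr (\<theta> - 1))"
    and tail: "\<And>n. emeasure M {\<omega>\<in>space M. \<forall>k\<le>n. Z k \<omega> \<in> A} \<le> ennreal (D * real (Suc n) powr (- \<theta>))"
  obtains B where "0 \<le> B" "\<And>n. (\<integral>\<^sup>+\<omega>. ennreal (w n (Z n \<omega>)) * indicator {\<omega>\<in>space M. \<forall>k\<le>n. Z k \<omega> \<in> A} \<omega> \<partial>M)
      \<le> ennreal (B * real (Suc n) powr (4 * \<kappa>))"
proof -
  interpret prob_space M using mc by (simp add: markov_chain_from_def)
  \<comment> \<open>The first entry starts the induction at n = 0, the second lets the source term
    be absorbed.\<close>
  define B where "B = max (w 0 z) (C * D / \<kappa>)"
  have B: "0 \<le> B" "C * D \<le> \<kappa> * B" using nonneg by (auto simp: B_def max_def field_simps)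
  define E where "E n = {\<omega>\<in>space M. \<forall>k\<le>n. Z k \<omega> \<in> A}" for n
  have "(\<integral>\<^sup>+\<omega>. ennreal (w n (Z n \<omega>)) * indicator (E n) \<omega> \<partial>M) \<le> ennreal (B * real (Suc n) powr (4 * \<kappa>))" for n
  proof (induction n)
    case 0
    have "AE \<omega> in M. Z 0 \<omega> = z" using mc by (simp add: markov_chain_from_def)
    then have "AE \<omega> in M. ennreal (w 0 (Z 0 \<omega>)) * indicator (E 0) \<omega> \<le> ennreal B"
      by eventually_elim (auto simp: indicator_def B_def intro!: ennreal_leI)
    then have "(\<integral>\<^sup>+\<omega>. ennreal (w 0 (Z 0 \<omega>)) * indicator (E 0) \<omega> \<partial>M) \<le> (\<integral>\<^sup>+\<omega>. ennreal B \<partial>M)"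
      by (rule nn_integral_mono_AE)
    then show ?case by (simp add: emeasure_space_1)
  next
    case (Suc n)
    define N where "N = real (Suc n)"
    have N: "1 \<le> N" "real (Suc (Suc n)) = N + 1" by (auto simp: N_def)
    have "(\<integral>\<^sup>+\<omega>. ennreal (w (Suc n) (Z (Suc n) \<omega>)) * indicator (E (Suc n)) \<omega> \<partial>M)
        \<le> ennreal (1 + \<kappa> / N) * (\<integral>\<^sup>+\<omega>. ennreal (w n (Z n \<omega>)) * indicator (E n) \<omega> \<partial>M)
          + ennreal (C * N powr (\<theta> - 1)) * emeasure M (E n)"
      unfolding E_def
    proof (rule killed_growth_step[OF mc A(1)])
      fix u assume "u \<in> A"
      then show "(\<integral>\<^sup>+v. ennreal (w (Suc n) v) \<partial>K u) \<le> ennreal (1 + \<kappa> / N) * ennreal (w n u) + ennreal (C * N powr (\<theta> - 1))"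
        using step[of u n] nonneg N by (simp add: N_def[symmetric] ennreal_mult[symmetric] ennreal_plus[symmetric] del: ennreal_plus)
    qed
    also have "\<dots> \<le> ennreal (1 + \<kappa> / N) * ennreal (B * N powr (4 * \<kappa>))
          + ennreal (C * N powr (\<theta> - 1)) * ennreal (D * N powr (- \<theta>))"
      using Suc tail[of n] by (intro add_mono mult_left_mono) (auto simp: N_def E_def)
    also have "\<dots> = ennreal ((1 + \<kappa> / N) * (B * N powr (4 * \<kappa>)) + C * N powr (\<theta> - 1) * (D * N powr (- \<theta>)))"
      using nonneg B N by (simp add: ennreal_mult ennreal_plus)
    also have "\<dots> \<le> ennreal (B * (N + 1) powr (4 * \<kappa>))"
    proof (rule ennreal_leI)
      have "C * N powr (\<theta> - 1) * (D * N powr (- \<theta>)) = C * D * (N powr (\<theta> - 1) * N powr (- \<theta>))" by simp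
      also have "N powr (\<theta> - 1) * N powr (- \<theta>) = 1 / N"
        using N by (simp add: powr_diff powr_minus divide_simps)
      also have "C * D * (1 / N) \<le> \<kappa> * B * (1 / N)" using B N by (intro mult_right_mono) auto
      also have "\<dots> \<le> \<kappa> * B * (1 / N) * N powr (4 * \<kappa>)"
      proof -
        have "1 \<le> N powr (4 * \<kappa>)" using N nonneg by (simp add: ge_one_powr_ge_zero)
        then have "\<kappa> * B * (1 / N) * 1 \<le> \<kappa> * B * (1 / N) * N powr (4 * \<kappa>)"
          using nonneg B N by (intro mult_left_mono) auto
        then show ?thesis by simp
      qed
      finally have "C * N powr (\<theta> - 1) * (D * N powr (- \<theta>)) \<le> \<kappa> * B * (1 / N) * N powr (4 * \<kappa>)" .
      moreover have "B * ((1 + 2 * \<kappa> / N) * N powr (4 * \<kappa>))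
          = (1 + \<kappa> / N) * (B * N powr (4 * \<kappa>)) + \<kappa> * B * (1 / N) * N powr (4 * \<kappa>)"
        using N by (simp add: field_simps)
      ultimately have "(1 + \<kappa> / N) * (B * N powr (4 * \<kappa>)) + C * N powr (\<theta> - 1) * (D * N powr (- \<theta>))
          \<le> B * ((1 + 2 * \<kappa> / N) * N powr (4 * \<kappa>))"
        by linarith
      also have "\<dots> \<le> B * (N + 1) powr (4 * \<kappa>)"
        using powr_Suc_ge[OF nonneg(1) N(1)] B by (intro mult_left_mono) auto
      finally show "(1 + \<kappa> / N) * (B * N powr (4 * \<kappa>)) + C * N powr (\<theta> - 1) * (D * N powr (- \<theta>))
          \<le> B * (N + 1) powr (4 * \<kappa>)" .
    qed
    finally show ?case unfolding N(2) .
  qed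
  then show thesis using that B unfolding E_def by blast
qed

text \<open>Markov's inequality. Staying in \<open>A\<close> up to time n means that the level is
  not hit before n + 1, hence \<open>Suc n\<close>; the hitting time is then at least 1, so its
  power s dominates its power \<theta>.\<close>

lemma hitting_time_tail:
  assumes mc: "markov_chain_from M Z K z" and fin: "moment_enat M (hitting_time Z x) s \<noteq> \<infinity>"
    and A: "\<And>u. u \<in> A \<Longrightarrow> x < fst u" and s: "0 < \<theta>" "\<theta> \<le> s"
  obtains D where "0 \<le> D" "\<And>n. emeasure M {\<omega>\<in>space M. \<forall>k\<le>n. Z k \<omega> \<in> A} \<le> ennreal (D * real (Suc n) powr (- \<theta>))"
proof -
  interpret prob_space M using mc by (simp add: markov_chain_from_def)
  have Z: "Z k \<in> measurable M (count_space UNIV)" for k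
    using mc by (simp add: markov_chain_from_def)
  define D where "D = enn2real (moment_enat M (hitting_time Z x) s)"
  have D: "moment_enat M (hitting_time Z x) s = ennreal D" "0 \<le> D"
    using fin by (auto simp: D_def less_top)
  define E where "E n = {\<omega>\<in>space M. \<forall>k\<le>n. Z k \<omega> \<in> A}" for n
  have E: "E n \<in> sets M" for n unfolding E_def by (rule sets_stays_in[OF Z])
  have "emeasure M (E n) \<le> ennreal (D * real (Suc n) powr (- \<theta>))" for n
  proof -
    have "ennreal (real (Suc n) powr \<theta>) * emeasure M (E n)
        = (\<integral>\<^sup>+\<omega>. ennreal (real (Suc n) powr \<theta>) * indicator (E n) \<omega> \<partial>M)"
      using E by (simp add: nn_integral_cmult_indicator)
    also have "\<dots> \<le> moment_enat M (hitting_time Z x) s"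
      unfolding moment_enat_def
    proof (rule nn_integral_mono)
      fix \<omega>
      show "ennreal (real (Suc n) powr \<theta>) * indicator (E n) \<omega>
          \<le> (case hitting_time Z x \<omega> of enat n \<Rightarrow> ennreal (real n powr s) | \<infinity> \<Rightarrow> \<infinity>)"
      proof (cases "\<omega> \<in> E n \<and> (\<exists>m. fst (Z m \<omega>) \<le> x)")
        case True
        define m where "m = (LEAST m. fst (Z m \<omega>) \<le> x)"
        have "fst (Z m \<omega>) \<le> x" unfolding m_def by (rule LeastI_ex) (use True in blast)
        moreover have "x < fst (Z k \<omega>)" if "k \<le> n" for k
          using True that A by (auto simp: E_def)
        ultimately have m: "Suc n \<le> m" by (metis not_less not_less_eq_eq)
        have "real (Suc n) powr \<theta> \<le> real m powr \<theta>"
          using m s by (intro powr_mono2) auto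
        also have "\<dots> \<le> real m powr s" using m s by (intro powr_mono) auto
        finally have "ennreal (real (Suc n) powr \<theta>) \<le> ennreal (real m powr s)" by (rule ennreal_leI)
        then show ?thesis using True by (simp add: hitting_time_def m_def[symmetric])
      \<comment> \<open>In the remaining case either the left side vanishes or the hitting time, and
        with it the integrand, is infinite.\<close>
      qed (auto simp: hitting_time_def indicator_def)
    qed
    finally have "ennreal (real (Suc n) powr \<theta> * measure M (E n)) \<le> ennreal D"
      by (simp add: D emeasure_eq_measure ennreal_mult)
    then have "real (Suc n) powr \<theta> * measure M (E n) \<le> D" using D(2) by simp
    then have "measure M (E n) \<le> D * real (Suc n) powr (- \<theta>)"
      by (simp add: powr_minus field_simps)
    then show ?thesis by (simp add: emeasure_eq_measure ennreal_leI)
  qed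
  then show thesis using that D(2) unfolding E_def by blast
qed

section \<open>Drift at infinity\<close>

text \<open>The estimates weight the drift with x + 1 instead of x; the difference is m x = (x * m
  x) / x, which tends to 0.\<close>

lemma tendsto_shifted_drift:
  fixes m :: "real \<Rightarrow> real"
  assumes "((\<lambda>x. x * m x - c) \<longlongrightarrow> 0) (at_top \<sqinter> principal S)"
  shows "((\<lambda>x. (x + 1) * m x) \<longlongrightarrow> c) (at_top \<sqinter> principal S)"
proof -
  let ?F = "at_top \<sqinter> principal S"
  have le: "?F \<le> at_top" by simp
  have 1: "((\<lambda>x. x * m x) \<longlongrightarrow> c) ?F"
    using tendsto_add[OF assms tendsto_const[of c]] by simp
  have "((\<lambda>x::real. inverse x) \<longlongrightarrow> 0) ?F"
    by (rule tendsto_mono[OF le]) real_asymp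
  then have "((\<lambda>x. x * m x + x * m x * inverse x) \<longlongrightarrow> c + c * 0) ?F"
    by (intro tendsto_intros 1)
  then have "((\<lambda>x. x * m x + x * m x * inverse x) \<longlongrightarrow> c) ?F" by simp
  moreover have "\<forall>\<^sub>F x in ?F. x * m x + x * m x * inverse x = (x + 1) * m x"
    using filter_leD[OF le eventually_gt_at_top[of 0]]
    by eventually_elim (simp add: field_simps)
  ultimately show ?thesis by (rule Lim_transform_eventually)
qed

text \<open>Limits are taken along \<open>line Sig i\<close> because the kernel is controlled only
  at states of \<open>Sig\<close>.\<close>

locale lamperti_strip =
  fixes Sig :: "(real \<times> 's::finite) set"
    and K :: "real \<times> 's \<Rightarrow> (real \<times> 's) pmf"
    and p Cp :: real
    and Q :: "'s \<Rightarrow> 's \<Rightarrow> real"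
    and c s2 :: "'s \<Rightarrow> real"
  assumes Sig_nonneg: "\<forall>z\<in>Sig. fst z \<ge> 0"
    and K_Sig: "\<forall>z\<in>Sig. set_pmf (K z) \<subseteq> Sig"
    and p_gt: "p > 2"
    and moment: "\<forall>z\<in>Sig. (\<integral>\<^sup>+ w. ennreal (\<bar>fst w - fst z\<bar> powr p) \<partial>measure_pmf (K z)) \<le> ennreal Cp"
    and Cp_nonneg: "0 \<le> Cp"
    and q_lim: "\<forall>i j. ((\<lambda>x. q_fun K i j x) \<longlongrightarrow> Q i j) (at_top \<sqinter> principal (line Sig i))"
    and mu_asym: "\<forall>i. ((\<lambda>x. x * mu_fun K i x - c i) \<longlongrightarrow> 0) (at_top \<sqinter> principal (line Sig i))"
    and sigma_asym: "\<forall>i. ((\<lambda>x. sigma2_fun K i x) \<longlongrightarrow> s2 i) (at_top \<sqinter> principal (line Sig i))"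
begin

lemma jump: "z \<in> Sig \<Longrightarrow> bounded_jump (K z) (fst z) p Cp"
  using Sig_nonneg K_Sig p_gt moment Cp_nonneg by unfold_locales auto

text \<open>There are finitely many lines, so their thresholds have a common upper bound.\<close>

lemma uniform_on_lines:
  assumes "\<And>i. eventually (P i) (at_top \<sqinter> principal (line Sig i))"
  obtains R where "\<And>x i. (x, i) \<in> Sig \<Longrightarrow> R < x \<Longrightarrow> P i x"
proof -
  have "\<forall>\<^sub>F x in at_top. \<forall>i. x \<in> line Sig i \<longrightarrow> P i x"
    using assms by (intro eventually_all_finite) (simp add: eventually_inf_principal)
  then show thesis
    using that unfolding eventually_at_top_linorder line_def by (metis less_imp_le mem_Collect_eq)
qed

lemma drift_bounded:
  obtains C1 R where "0 \<le> C1" "\<And>z. z \<in> Sig \<Longrightarrow> R < fst z \<Longrightarrow> (fst z + 1) * bounded_jump.drift (K z) (fst z) \<le> C1"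
proof -
  define C1 where "C1 = (\<Sum>i\<in>UNIV. \<bar>c i\<bar>) + 1"
  have C1: "c i < C1" for i
    using member_le_sum[of i UNIV "\<lambda>i. \<bar>c i\<bar>"] unfolding C1_def by (auto simp: abs_le_iff)
  have "\<forall>\<^sub>F x in at_top \<sqinter> principal (line Sig i). (x + 1) * mu_fun K i x < C1" for i
    using tendsto_shifted_drift[OF mu_asym[rule_format, of i]] C1[of i] by (rule order_tendstoD)
  then obtain R where "\<And>x i. (x, i) \<in> Sig \<Longrightarrow> R < x \<Longrightarrow> (x + 1) * mu_fun K i x < C1"
    by (rule uniform_on_lines) blast
  then have "(fst z + 1) * bounded_jump.drift (K z) (fst z) \<le> C1" if "z \<in> Sig" "R < fst z" for z
    using that bounded_jump.drift_def[OF jump[OF that(1)]]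
    by (cases z) (auto simp: mu_fun_def less_imp_le)
  moreover have "0 \<le> C1" unfolding C1_def by (simp add: sum_nonneg)
  ultimately show thesis using that by blast
qed

text \<open>Far out, the bracket of \<open>lyapunov_lower\<close> without its \<open>e\<close> term
  tends to a value of at least \<open>b i + d\<close>. One half of \<open>d\<close> is given up to
  the limit, the other half to the quadratic Taylor slack.\<close>

lemma lyapunov_submartingale:
  fixes b :: "'s \<Rightarrow> real"
  assumes q: "0 < q" "q \<le> p" and b: "\<And>i. 0 \<le> b i" and d: "0 < d"
    "\<And>i. d \<le> 2 * c i + (q - 1) * s2 i + (\<Sum>j\<in>UNIV. Q i j * b j) - b i"
  defines "f \<equiv> \<lambda>z. (fst z + 1) powr q + q / 2 * b (snd z) * (fst z + 1) powr (q - 2)"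
  obtains R where "\<And>z. z \<in> Sig \<Longrightarrow> R < fst z \<Longrightarrow> ennreal (f z) \<le> (\<integral>\<^sup>+v. ennreal (f v) \<partial>K z)"
proof -
  \<comment> \<open>Chosen so that \<open>2 / q * e * (1 + Cp) = d / 2\<close>, where
    \<open>1 + Cp\<close> bounds \<open>sqdrift\<close>.\<close>
  define e where "e = q * d / (4 * (1 + Cp))"
  have e: "0 < e" using q d Cp_nonneg by (simp add: e_def)
  obtain T where T: "0 \<le> T" "\<And>t. -1 \<le> t \<Longrightarrow>
      \<bar>(1 + t) powr q - 1 - q * t - q * (q - 1) / 2 * t\<^sup>2\<bar> \<le> e * t\<^sup>2 + T * \<bar>t\<bar> powr p"
    using powr_taylor2[OF q p_gt e] by blast
  define B where "B = Max (range b)"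
  have B: "b i \<le> B" for i unfolding B_def by simp
  define \<Phi> where "\<Phi> i x = 2 * ((x + 1) * mu_fun K i x) + (q - 1) * sigma2_fun K i x
      - 2 / q * T * Cp * (x + 1) powr (2 - p) + (\<Sum>j\<in>UNIV. b j * q_fun K i j x)
      - B * (\<bar>q - 2\<bar> + 1) * (1 + Cp) * inverse (x + 1)" for i x
  have "\<forall>\<^sub>F x in at_top \<sqinter> principal (line Sig i). b i + d / 2 < \<Phi> i x" for i
  proof -
    let ?F = "at_top \<sqinter> principal (line Sig i)"
    have le: "?F \<le> at_top" by simp
    have p1: "((\<lambda>x::real. (x + 1) powr (2 - p)) \<longlongrightarrow> 0) ?F"
      by (rule tendsto_mono[OF le]) (use p_gt in real_asymp)
    have p2: "((\<lambda>x::real. inverse (x + 1)) \<longlongrightarrow> 0) ?F"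
      by (rule tendsto_mono[OF le]) real_asymp
    have "(\<Phi> i \<longlongrightarrow> 2 * c i + (q - 1) * s2 i - 2 / q * T * Cp * 0 + (\<Sum>j\<in>UNIV. b j * Q i j)
        - B * (\<bar>q - 2\<bar> + 1) * (1 + Cp) * 0) ?F"
      unfolding \<Phi>_def
      by (intro tendsto_diff tendsto_add tendsto_sum tendsto_mult tendsto_const p1 p2
            tendsto_shifted_drift q_lim[rule_format] mu_asym[rule_format] sigma_asym[rule_format])
    moreover have "b i + d / 2 < 2 * c i + (q - 1) * s2 i - 2 / q * T * Cp * 0 + (\<Sum>j\<in>UNIV. b j * Q i j)
        - B * (\<bar>q - 2\<bar> + 1) * (1 + Cp) * 0"
      using d(1) d(2)[of i] by (simp add: mult.commute)
    ultimately show ?thesis by (rule order_tendstoD)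
  qed
  then obtain R where R: "\<And>x i. (x, i) \<in> Sig \<Longrightarrow> R < x \<Longrightarrow> b i + d / 2 < \<Phi> i x"
    by (rule uniform_on_lines) blast
  have "ennreal (f z) \<le> (\<integral>\<^sup>+v. ennreal (f v) \<partial>K z)" if z: "z \<in> Sig" "R < fst z" for z
  proof -
    obtain x i where zx: "z = (x, i)" by (cases z)
    interpret bounded_jump "K z" x p Cp using jump[OF z(1)] zx by simp
    have dr: "drift = mu_fun K i x" "sqdrift = sigma2_fun K i x"
      unfolding drift_def sqdrift_def mu_fun_def sigma2_fun_def by (simp_all add: zx)
    have qf: "measure_pmf.prob (K z) {w. snd w = j} = q_fun K i j x" for j
      by (simp add: q_fun_def zx)
    have eq: "\<Phi> i x - 2 / q * e * sqdrift = 2 * ((x + 1) * drift) + (q - 1) * sqdrift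
        - 2 / q * e * sqdrift - 2 / q * T * Cp * (x + 1) powr (2 - p)
        + (\<Sum>j\<in>UNIV. b j * measure_pmf.prob (K z) {w. snd w = j})
        - B * (\<bar>q - 2\<bar> + 1) * (1 + Cp) * inverse (x + 1)"
      unfolding \<Phi>_def dr qf by simp
    have "2 / q * e * sqdrift \<le> 2 / q * e * (1 + Cp)"
      using sqdrift_le q e by (intro mult_left_mono) auto
    also have "\<dots> = d / 2" using q Cp_nonneg by (simp add: e_def field_simps)
    finally have "b i \<le> \<Phi> i x - 2 / q * e * sqdrift"
      using R[of x i] z zx by simp
    then have "(x + 1) powr q + q / 2 * (x + 1) powr (q - 2) * b i
        \<le> (x + 1) powr q + q / 2 * (x + 1) powr (q - 2) * (\<Phi> i x - 2 / q * e * sqdrift)"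
      using q by (intro add_left_mono mult_left_mono) auto
    then have "ennreal (f z) \<le> ennreal ((x + 1) powr q + q / 2 * (x + 1) powr (q - 2) * (\<Phi> i x - 2 / q * e * sqdrift))"
      by (intro ennreal_leI) (simp add: f_def zx mult_ac)
    also have "\<dots> \<le> (\<integral>\<^sup>+v. ennreal (f v) \<partial>K z)"
      unfolding eq f_def by (rule lyapunov_lower[OF q(1) T b B])
    finally show ?thesis .
  qed
  then show thesis using that by blast
qed

end

section \<open>Assembly: a finite moment contradicts the submartingale property\<close>

theorem theorem2p4:
  fixes Sig :: "(real \<times> 's::finite) set"
    and K :: "real \<times> 's \<Rightarrow> (real \<times> 's) pmf"
    and p Cp \<theta> s :: real
    and Q :: "'s \<Rightarrow> 's \<Rightarrow> real"
    and \<pi> c s2 :: "'s \<Rightarrow> real"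
  assumes Sig_nonneg: "\<forall>z\<in>Sig. fst z \<ge> 0"
    and Sig_lf: "locally_finite_set Sig"
    and K_Sig: "\<forall>z\<in>Sig. set_pmf (K z) \<subseteq> Sig"
    and irred: "irreducible_kernel K Sig"
    and lines_unbdd: "\<forall>k. \<not> bdd_above (line Sig k)"
    and p_gt: "p > 2"
    and moment: "\<forall>z\<in>Sig. (\<integral>\<^sup>+ w. ennreal (\<bar>fst w - fst z\<bar> powr p) \<partial>measure_pmf (K z)) \<le> ennreal Cp"
    and q_lim: "\<forall>i j. ((\<lambda>x. q_fun K i j x) \<longlongrightarrow> Q i j) (at_top \<sqinter> principal (line Sig i))"
    and Q_stoch: "stochastic_matrix Q"
    and Q_irred: "irreducible_matrix Q"
    and \<pi>_stat: "stationary_distribution Q \<pi>"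
    and s2_nonneg: "\<forall>i. s2 i \<ge> 0"
    and s2_nz: "\<exists>i. s2 i \<noteq> 0"
    and mu_asym: "\<forall>i. ((\<lambda>x. x * mu_fun K i x - c i) \<longlongrightarrow> 0) (at_top \<sqinter> principal (line Sig i))"
    and sigma_asym: "\<forall>i. ((\<lambda>x. sigma2_fun K i x) \<longlongrightarrow> s2 i) (at_top \<sqinter> principal (line Sig i))"
    and \<theta>_pos: "0 < \<theta>" and \<theta>_le: "\<theta> \<le> p / 2"
    and drift: "(\<Sum>i\<in>UNIV. (2 * c i + (2 * \<theta> - 1) * s2 i) * \<pi> i) > 0"
    and s_ge: "s \<ge> \<theta>"
  shows "\<forall>x\<ge>0. \<exists>y0. \<forall>z\<in>Sig. fst z > max x y0 \<longrightarrow>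
           (\<forall>(M :: 'w measure) Z. markov_chain_from M Z K z \<longrightarrow>
              moment_enat M (hitting_time Z x) s = \<infinity>)"
proof (intro allI impI)
  fix x :: real assume "0 \<le> x"
  \<comment> \<open>\<open>ennreal\<close> sends a negative \<open>Cp\<close> to 0, so the moment
    bound survives the replacement and the locale gets a nonnegative constant.\<close>
  define Cp' where "Cp' = max 0 Cp"
  interpret lamperti_strip Sig K p Cp' Q c s2
  proof unfold_locales
    show "\<forall>z\<in>Sig. (\<integral>\<^sup>+ w. ennreal (\<bar>fst w - fst z\<bar> powr p) \<partial>measure_pmf (K z)) \<le> ennreal Cp'"
      using moment by (auto simp: Cp'_def intro: order_trans ennreal_leI)
  qed (use Sig_nonneg K_Sig p_gt q_lim mu_asym sigma_asym in \<open>auto simp: Cp'_def\<close>)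
  \<comment> \<open>Local finiteness enters through countability of the state space, on which the
    summation over paths relies.\<close>
  have "Sig = (\<Union>n. Sig \<inter> ({0..real n} \<times> UNIV))"
    using Sig_nonneg real_arch_simple by fastforce
  moreover have "countable (\<Union>n. Sig \<inter> ({0..real n} \<times> UNIV))"
    using Sig_lf by (intro countable_UN) (auto simp: locally_finite_set_def intro: countable_finite)
  ultimately have Sig_countable: "countable Sig" by simp
  define \<Sigma>\<sigma> where "\<Sigma>\<sigma> = (\<Sum>i\<in>UNIV. s2 i * \<pi> i)"
  define \<Sigma>d where "\<Sigma>d = (\<Sum>i\<in>UNIV. (2 * c i + (2 * \<theta> - 1) * s2 i) * \<pi> i)"
  have "\<forall>i. 0 \<le> \<pi> i" using \<pi>_stat unfolding stationary_distribution_def by blast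
  then have "0 \<le> \<Sigma>\<sigma>" using s2_nonneg unfolding \<Sigma>\<sigma>_def by (intro sum_nonneg) simp
  \<comment> \<open>Lowering \<theta> by \<delta> lowers the drift sum by
    \<open>2 * \<delta> * \<Sigma>\<sigma>\<close>. The second entry of the minimum keeps this loss
    below \<open>\<Sigma>d\<close>, the first keeps \<theta>' positive.\<close>
  define \<theta>' where "\<theta>' = \<theta> - min (\<theta> / 2) (\<Sigma>d / (4 * (\<Sigma>\<sigma> + 1)))"
  have \<theta>': "0 < \<theta>'" "\<theta>' < \<theta>"
  proof -
    have "0 < min (\<theta> / 2) (\<Sigma>d / (4 * (\<Sigma>\<sigma> + 1)))"
      using \<theta>_pos drift \<open>0 \<le> \<Sigma>\<sigma>\<close> by (simp add: \<Sigma>d_def)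
    moreover have "min (\<theta> / 2) (\<Sigma>d / (4 * (\<Sigma>\<sigma> + 1))) \<le> \<theta> / 2" by (rule min.cobounded1)
    ultimately show "0 < \<theta>'" "\<theta>' < \<theta>" using \<theta>_pos unfolding \<theta>'_def by linarith+
  qed
  define q where "q = 2 * \<theta>'"
  have q: "0 < q" "q \<le> p" using \<theta>' \<theta>_le by (auto simp: q_def)
  have "0 < (\<Sum>i\<in>UNIV. (2 * c i + (q - 1) * s2 i) * \<pi> i)"
  proof -
    have "(\<Sum>i\<in>UNIV. (2 * c i + (q - 1) * s2 i) * \<pi> i) = \<Sigma>d - 2 * (\<theta> - \<theta>') * \<Sigma>\<sigma>"
      unfolding \<Sigma>d_def \<Sigma>\<sigma>_def q_def
      by (simp add: sum_distrib_left sum_subtractf[symmetric] algebra_simps)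
    moreover have "2 * (\<theta> - \<theta>') * \<Sigma>\<sigma> \<le> 2 * (\<Sigma>d / (4 * (\<Sigma>\<sigma> + 1))) * \<Sigma>\<sigma>"
      using \<open>0 \<le> \<Sigma>\<sigma>\<close> by (intro mult_right_mono) (auto simp: \<theta>'_def)
    moreover have "2 * (\<Sigma>d / (4 * (\<Sigma>\<sigma> + 1))) * \<Sigma>\<sigma> < \<Sigma>d"
      using \<open>0 \<le> \<Sigma>\<sigma>\<close> drift unfolding \<Sigma>d_def[symmetric]
      by (simp add: field_simps add_strict_increasing)
    ultimately show ?thesis by linarith
  qed
  then obtain b d where b: "\<And>i. 0 \<le> b i" and d: "0 < d"
      "\<And>i. d \<le> 2 * c i + (q - 1) * s2 i + (\<Sum>j\<in>UNIV. Q i j * b j) - b i"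
    using corrector_exists[OF Q_stoch \<pi>_stat, of "\<lambda>i. 2 * c i + (q - 1) * s2 i"] by metis
  define f :: "real \<times> 's \<Rightarrow> real"
    where "f = (\<lambda>z. (fst z + 1) powr q + q / 2 * b (snd z) * (fst z + 1) powr (q - 2))"
  obtain R1 where R1: "\<And>z. z \<in> Sig \<Longrightarrow> R1 < fst z \<Longrightarrow> ennreal (f z) \<le> (\<integral>\<^sup>+v. ennreal (f v) \<partial>K z)"
    using lyapunov_submartingale[OF q b d] unfolding f_def by blast
  obtain C1 R2 where C1: "0 \<le> C1"
    and R2: "\<And>z. z \<in> Sig \<Longrightarrow> R2 < fst z \<Longrightarrow> (fst z + 1) * bounded_jump.drift (K z) (fst z) \<le> C1"
    using drift_bounded by blast
  \<comment> \<open>Makes 4 * \<kappa> half of \<theta> - \<theta>', so that the growth of the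
    killed expectation loses against the decay N^(\<theta>' - \<theta>).\<close>
  define \<kappa> where "\<kappa> = (\<theta> - \<theta>') / 8"
  have \<kappa>: "0 < \<kappa>" using \<theta>' by (simp add: \<kappa>_def)
  obtain w :: "nat \<Rightarrow> real \<Rightarrow> real" and C where w: "0 \<le> C" "\<And>n x. 0 \<le> w n x"
    "\<And>(k :: (real \<times> 's) pmf) x n. bounded_jump k x p Cp' \<Longrightarrow>
        (x + 1) * bounded_jump.drift k x \<le> C1 \<Longrightarrow>
        (\<integral>\<^sup>+v. ennreal (w (Suc n) (fst v)) \<partial>k)
          \<le> ennreal ((1 + \<kappa> / real (Suc n)) * w n x + C * real (Suc n) powr (\<theta> - 1))"
    "\<And>n x. 0 \<le> x \<Longrightarrow> (x + 1) powr (2 * \<theta>') \<le> real (Suc n) powr (\<theta>' - \<theta>) * w n x"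
    using growth_function_exists[OF \<theta>_pos \<theta>_le p_gt \<theta>' \<kappa> C1 Cp_nonneg] by metis
  \<comment> \<open>Above \<open>R\<close> all one-step estimates hold, and R \<ge> x makes survival
    in \<open>A\<close> imply that the level x has not been reached.\<close>
  define R where "R = max x (max R1 R2)"
  define A where "A = {z \<in> Sig. R < fst z}"
  have A: "countable A" using Sig_countable unfolding A_def by (rule countable_subset[rotated]) auto
  define B where "B = Max (range b)"
  have B: "b i \<le> B" for i unfolding B_def by simp
  have B0: "0 \<le> B" using b B order_trans by blast
  \<comment> \<open>As y \<ge> 1 on \<open>Sig\<close>, the corrector term is at most
    \<open>q / 2 * B\<close> times y^q.\<close>
  define cf where "cf = 1 + q / 2 * B"
  have cf: "1 \<le> cf" using q B0 by (simp add: cf_def)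
  have f_nonneg: "0 \<le> f z" for z using q b by (simp add: f_def)
  have f_le: "f z \<le> cf * (fst z + 1) powr q" if "z \<in> Sig" for z
  proof -
    have "0 \<le> fst z" using Sig_nonneg that by blast
    then have "q / 2 * b (snd z) * (fst z + 1) powr (q - 2) \<le> q / 2 * B * (fst z + 1) powr q"
      using q b B B0 by (intro mult_mono powr_mono) auto
    then show ?thesis by (simp add: f_def cf_def distrib_right)
  qed
  \<comment> \<open>Bounds \<open>f\<close> at every state of \<open>Sig\<close> up to height
    \<open>R\<close>, hence after leaving \<open>A\<close>, however deep the jump.\<close>
  define CR where "CR = cf * (R + 1) powr q"
  have CR: "0 \<le> CR" using cf by (simp add: CR_def)
  have sub: "ennreal (f u) \<le> (\<integral>\<^sup>+v. (if v \<in> A then ennreal (f v) else ennreal CR) \<partial>K u)" if "u \<in> A" for u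
  proof -
    have "u \<in> Sig" "R1 < fst u" using that by (auto simp: A_def R_def)
    then have "ennreal (f u) \<le> (\<integral>\<^sup>+v. ennreal (f v) \<partial>K u)" by (rule R1)
    also have "\<dots> \<le> (\<integral>\<^sup>+v. (if v \<in> A then ennreal (f v) else ennreal CR) \<partial>K u)"
    proof (intro nn_integral_mono_AE, unfold AE_measure_pmf_iff, intro ballI)
      fix v assume "v \<in> set_pmf (K u)"
      then have v: "v \<in> Sig" using K_Sig \<open>u \<in> Sig\<close> by blast
      show "ennreal (f v) \<le> (if v \<in> A then ennreal (f v) else ennreal CR)"
      proof (cases "v \<in> A")
        case False
        then have "fst v \<le> R" using v by (auto simp: A_def)
        have "f v \<le> cf * (fst v + 1) powr q" by (rule f_le[OF v])
        also have "\<dots> \<le> CR"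
          unfolding CR_def using cf q Sig_nonneg v \<open>fst v \<le> R\<close>
          by (intro mult_left_mono powr_mono2) auto
        finally show ?thesis using False by (simp add: ennreal_leI)
      qed simp
    qed
    finally show ?thesis .
  qed
  \<comment> \<open>Forces f z > CR + 1. The threshold is fixed before \<open>M\<close> and
    \<open>Z\<close>; the constants \<open>D\<close> and \<open>G\<close> below depend on them but
    disappear in the limit.\<close>
  define y0 where "y0 = max R ((CR + 1) powr (1 / q))"
  have "moment_enat M (hitting_time Z x) s = \<infinity>"
    if z: "z \<in> Sig" "max x y0 < fst z" and mc: "markov_chain_from M Z K z"
    for z and M :: "'w measure" and Z
  proof (rule ccontr)
    assume fin: "moment_enat M (hitting_time Z x) s \<noteq> \<infinity>"
    have zA: "z \<in> A" using z by (auto simp: A_def y0_def)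
    obtain D where D: "0 \<le> D"
      "\<And>n. emeasure M {\<omega>\<in>space M. \<forall>k\<le>n. Z k \<omega> \<in> A} \<le> ennreal (D * real (Suc n) powr (- \<theta>))"
      using hitting_time_tail[OF mc fin _ \<theta>_pos s_ge, of A] by (auto simp: A_def R_def)
    have step: "(\<integral>\<^sup>+v. ennreal (w (Suc n) (fst v)) \<partial>K u)
        \<le> ennreal ((1 + \<kappa> / real (Suc n)) * w n (fst u) + C * real (Suc n) powr (\<theta> - 1))"
      if "u \<in> A" for u n
      using that by (intro w(3) jump R2) (auto simp: A_def R_def)
    obtain G where G: "0 \<le> G" "\<And>n. (\<integral>\<^sup>+\<omega>. ennreal (w n (fst (Z n \<omega>))) *
        indicator {\<omega>\<in>space M. \<forall>k\<le>n. Z k \<omega> \<in> A} \<omega> \<partial>M) \<le> ennreal (G * real (Suc n) powr (4 * \<kappa>))"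
      using killed_growth_bound[where w = "\<lambda>n u. w n (fst u)", OF mc A zA \<kappa> w(1) D(1) w(2) step D(2)]
      by blast
    have bound: "f z \<le> cf * G * real (Suc n) powr (4 * \<kappa> - (\<theta> - \<theta>')) + CR" for n
    proof -
      define E where "E = {\<omega>\<in>space M. \<forall>k\<le>n. Z k \<omega> \<in> A}"
      define N where "N = real (Suc n)"
      have Zm: "Z k \<in> measurable M (count_space UNIV)" for k
        using mc by (simp add: markov_chain_from_def)
      have [measurable]: "E \<in> sets M" unfolding E_def by (rule sets_stays_in[OF Zm])
      have [measurable]: "(\<lambda>\<omega>. ennreal (w n (fst (Z n \<omega>)))) \<in> borel_measurable M"
        using measurable_compose[OF Zm[of n], of "\<lambda>u. ennreal (w n (fst u))" borel] by simp
      have "(\<integral>\<^sup>+\<omega>. ennreal (f (Z n \<omega>)) * indicator E \<omega> \<partial>M)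
          \<le> (\<integral>\<^sup>+\<omega>. ennreal (cf * N powr (\<theta>' - \<theta>)) * (ennreal (w n (fst (Z n \<omega>))) * indicator E \<omega>) \<partial>M)"
      proof (rule nn_integral_mono)
        fix \<omega>
        show "ennreal (f (Z n \<omega>)) * indicator E \<omega>
            \<le> ennreal (cf * N powr (\<theta>' - \<theta>)) * (ennreal (w n (fst (Z n \<omega>))) * indicator E \<omega>)"
        proof (cases "\<omega> \<in> E")
          case True
          then have Zn: "Z n \<omega> \<in> Sig" by (auto simp: E_def A_def)
          have "f (Z n \<omega>) \<le> cf * (fst (Z n \<omega>) + 1) powr q" by (rule f_le[OF Zn])
          also have "\<dots> \<le> cf * (N powr (\<theta>' - \<theta>) * w n (fst (Z n \<omega>)))"
            unfolding N_def q_def using cf Sig_nonneg Zn by (intro mult_left_mono w(4)) auto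
          finally have "ennreal (f (Z n \<omega>)) \<le> ennreal (cf * N powr (\<theta>' - \<theta>) * w n (fst (Z n \<omega>)))"
            by (intro ennreal_leI) (simp add: mult.assoc)
          then show ?thesis using True cf w(2) by (simp add: ennreal_mult)
        qed simp
      qed
      also have "\<dots> = ennreal (cf * N powr (\<theta>' - \<theta>)) * (\<integral>\<^sup>+\<omega>. ennreal (w n (fst (Z n \<omega>))) * indicator E \<omega> \<partial>M)"
        by (rule nn_integral_cmult) measurable
      also have "\<dots> \<le> ennreal (cf * N powr (\<theta>' - \<theta>)) * ennreal (G * N powr (4 * \<kappa>))"
        using G(2)[of n] by (intro mult_left_mono) (auto simp: E_def N_def)
      also have "\<dots> = ennreal (cf * G * N powr (4 * \<kappa> - (\<theta> - \<theta>')))"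
        using cf G(1) by (simp add: ennreal_mult[symmetric] powr_add[symmetric] powr_diff field_simps)
      finally have "(\<integral>\<^sup>+\<omega>. ennreal (f (Z n \<omega>)) * indicator E \<omega> \<partial>M) \<le> \<dots>" .
      then have "ennreal (f z) \<le> ennreal (cf * G * N powr (4 * \<kappa> - (\<theta> - \<theta>'))) + ennreal CR"
        using killed_submartingale_bound[OF mc A zA, of "\<lambda>u. ennreal (f u)" "ennreal CR" n] sub
        unfolding E_def by (meson add_right_mono order_trans)
      also have "\<dots> = ennreal (cf * G * N powr (4 * \<kappa> - (\<theta> - \<theta>')) + CR)"
        using cf G(1) CR by (intro ennreal_plus[symmetric]) auto
      finally show ?thesis unfolding N_def using cf G(1) CR by (subst (asm) ennreal_le_iff) auto
    qed
    \<comment> \<open>By the choice of \<kappa> the exponent is -(\<theta> - \<theta>') / 2, so the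
      killed expectation vanishes in the limit and f z \<le> CR remains, against the choice of
      \<open>y0\<close>.\<close>
    have "(\<lambda>n. cf * G * real (Suc n) powr (4 * \<kappa> - (\<theta> - \<theta>')) + CR) \<longlonglongrightarrow> cf * G * 0 + CR"
    proof (intro tendsto_intros)
      have neg: "4 * \<kappa> - (\<theta> - \<theta>') < 0" using \<theta>' by (simp add: \<kappa>_def)
      show "(\<lambda>n. real (Suc n) powr (4 * \<kappa> - (\<theta> - \<theta>'))) \<longlonglongrightarrow> 0"
        using neg by (intro tendsto_neg_powr filterlim_compose[OF filterlim_real_sequentially filterlim_Suc])
    qed
    then have "f z \<le> cf * G * 0 + CR"
      by (rule LIMSEQ_le_const) (use bound in blast)
    moreover have "CR + 1 < f z"
    proof -
      have "CR + 1 = ((CR + 1) powr (1 / q)) powr q" using CR q by (simp add: powr_powr)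
      also have "\<dots> < (fst z + 1) powr q"
        using z q by (intro powr_less_mono2) (auto simp: y0_def)
      also have "\<dots> \<le> f z" using q b by (simp add: f_def)
      finally show ?thesis .
    qed
    ultimately show False by simp
  qed
  then show "\<exists>y0. \<forall>z\<in>Sig. fst z > max x y0 \<longrightarrow>
           (\<forall>(M :: 'w measure) Z. markov_chain_from M Z K z \<longrightarrow>
              moment_enat M (hitting_time Z x) s = \<infinity>)"
    by blast
qed

end
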